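(* Suppose that $m,n\to\infty$ with $0<n\le m$ and $n/m\to\alpha\in[0,1]$. Then \begin{align*} \mathbb E\bigl(d^{\mathsf U}(\mathcal T_{m,n})\bigr)&\to\mathbb E D^{\mathsf U}_\alpha=\tfrac14\bigl(e^{2\alpha}-1\bigr)+\tfrac{\alpha}2,\\ \mathbb E\bigl(d^{\mathsf L}(\mathcal T_{m,n})\bigr)&\to\mathbb E D^{\mathsf L}_\alpha=\tfrac1{8\alpha}\bigl(e^{2\alpha}-1\bigr)+\tfrac{\alpha}4-\tfrac14,\\ \mathbb E\bigl(d^{\mathsf E}(\mathcal T_{m,n})\bigr)&\to\mathbb E D^{\mathsf E}_\alpha=\tfrac1\alpha\bigl(e^{\alpha}-1-\alpha\bigr), \end{align*} where for $\alpha=0$ the expressions on the right are interpreted as their limits as $\alpha\to0$.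
   Context: Hashing with coalesced chains. Let $0\le n\le m$ be integers. Items $x_1,\dots,x_n$ are placed sequentially into a table with $m$ cells $1,\dots,m$, using hash addresses $h_1,\dots,h_n\in\{1,\dots,m\}$. Each cell has a link field, initially null. If cell $h_i$ is empty, $x_i$ is inserted there (creating a new chain of length 1). If cell $h_i$ is occupied, $x_i$ is stored in the empty cell $j$ with largest index, and $j$ is linked into the chain containing $h_i$ according to one of two policies: - $\mathsf L$ (late-insertion): follow the links from $h_i$ to the end of the chain (a null link) and append a link there to cell $j$. - $\mathsf E$ (early-insertion): cell $j$ is linked into the chain immediately after $h_i$: if the link from $h_i$ points to $k$ (null or not), this link is reset to $j$, and the link of $j$ is set to $k$. Both policies give the same occupied cells and the same partition of them into chains; only the order within chains may differ. A hash table $\mathcal T$ is encoded by $m$, $n$ and $(h_1,\dots,h_n)$, and both policies are considered together. The random hash table $\mathcal T_{m,n}$ has $m$ cells and $n$ items, with $h_1,\dots,h_n$ i.i.d. uniform on $\{1,\dots,m\}$. For $\Xi\in\{\mathsf L,\mathsf E\}$, $d_i^\Xi(\mathcal T)$ is the final displacement of item $x_i$, i.e. the number of links one has to follow from $h_i$ until $x_i$ is found in the final table (built with policy $\Xi$); and, if $n>0$, $d^\Xi(\mathcal T):=d_I^\Xi(\mathcal T)$ where $I$ is uniform on $\{1,\dots,n\}$, independent of $\mathcal T$. For an unsuccessful search starting at cell $j$, $d_j^{\mathsf U}(\mathcal T)$ is the number of occupied cells encountered: $0$ if cell $j$ is empty, and otherwise $1$ plus the number of cells after $j$ in its chain. Put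 $d^{\mathsf U}(\mathcal T):=d_J^{\mathsf U}(\mathcal T)$ where $J$ is uniform on $\{1,\dots,m\}$, independent of $\mathcal T$ (its distribution is the same for both policies). For $\alpha\in[0,1]$ and $\Xi\in\{\mathsf U,\mathsf L,\mathsf E\}$, $D^\Xi_\alpha$ is a random variable with $\mathbb P(D^\Xi_\alpha=k)=p^\Xi_\alpha(k)$, $k=0,1,\dots$, where $p^{\mathsf U}_\alpha(0)=1-\alpha$ and $p^{\mathsf U}_\alpha(k)=\int_0^\alpha(1-\alpha+t)(1-e^{-t})^{k-1}\,dt$ for $k\ge1$; $p^{\mathsf L}_\alpha(0)=1-\alpha/2$ and $p^{\mathsf L}_\alpha(k)=\frac1\alpha\int_0^\alpha\bigl(\alpha-t-(\alpha-t)^2/2\bigr)(1-e^{-t})^{k-1}\,dt$ for $k\ge1$; $p^{\mathsf E}_\alpha(0)=1-\alpha/2$ and $p^{\mathsf E}_\alpha(k)=\frac1\alpha\int_0^\alpha(\alpha-t)e^{-t}(1-e^{-t})^{k-1}\,dt$ for $k\ge1$; for $\alpha=0$, $p^{\mathsf L}_0(k)=p^{\mathsf E}_0(k)=0$ when $k\ge1$. *)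

theory Defs
  imports "HOL-Probability.Probability"
begin

section \<open>Hashing with coalesced chains\<close>

text \<open>The cells are \<open>1, \<dots>, m\<close>.  \<open>item T c = Some i\<close> means that cell \<open>c\<close> contains the item \<open>x\<^sub>i\<close>,
  and \<open>None\<close> in \<open>item\<close> and \<open>link\<close> stands for an empty cell and a null link, respectively.\<close>

datatype policy = Late | Early

record hash_table =
  item :: "nat \<Rightarrow> nat option"
  link :: "nat \<Rightarrow> nat option"

text \<open>The cell reached from \<open>c\<close> by following \<open>k\<close> links, if there are so many.\<close>

primrec follow :: "hash_table \<Rightarrow> nat \<Rightarrow> nat \<Rightarrow> nat option" where
  "follow T c 0 = Some c"
| "follow T c (Suc k) = (case follow T c k of None \<Rightarrow> None | Some c' \<Rightarrow> link T c')"

text \<open>Chains arising from insertions are finite and acyclic, so the \<open>LEAST\<close> below exists.\<close>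

definition chain_end :: "hash_table \<Rightarrow> nat \<Rightarrow> nat" where
  "chain_end T c = the (follow T c (LEAST k. follow T c (Suc k) = None))"

definition insert_item :: "policy \<Rightarrow> nat \<Rightarrow> nat \<Rightarrow> nat \<Rightarrow> hash_table \<Rightarrow> hash_table" where
  "insert_item pol m i a T =
    (if item T a = None then T\<lparr>item := (item T)(a := Some i)\<rparr>
     else let j = Max {c \<in> {1..m}. item T c = None} in
       \<lparr>item = (item T)(j := Some i),
        link = (case pol of
            Late \<Rightarrow> (link T)(chain_end T a := Some j)
          | Early \<Rightarrow> (link T)(j := link T a, a := Some j))\<rparr>)"

text \<open>The table after inserting \<open>x\<^sub>1, \<dots>, x\<^sub>n\<close> with hash addresses \<open>h 1, \<dots>, h n\<close>.\<close>

primrec build_table :: "policy \<Rightarrow> nat \<Rightarrow> (nat \<Rightarrow> nat) \<Rightarrow> nat \<Rightarrow> hash_table" where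
  "build_table pol m h 0 = \<lparr>item = (\<lambda>_. None), link = (\<lambda>_. None)\<rparr>"
| "build_table pol m h (Suc n) = insert_item pol m (Suc n) (h (Suc n)) (build_table pol m h n)"

definition displacement :: "policy \<Rightarrow> nat \<Rightarrow> nat \<Rightarrow> (nat \<Rightarrow> nat) \<Rightarrow> nat \<Rightarrow> nat" where
  "displacement pol m n h i =
    (let T = build_table pol m h n in
     LEAST k. \<exists>c. follow T (h i) k = Some c \<and> item T c = Some i)"

definition unsuccessful :: "policy \<Rightarrow> nat \<Rightarrow> nat \<Rightarrow> (nat \<Rightarrow> nat) \<Rightarrow> nat \<Rightarrow> nat" where
  "unsuccessful pol m n h j =
    (let T = build_table pol m h n in
     if item T j = None then 0 else 1 + card {c. \<exists>k>0. follow T j k = Some c})"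


section \<open>The random hash table\<close>

definition random_hashes :: "nat \<Rightarrow> nat \<Rightarrow> (nat \<Rightarrow> nat) pmf" where
  "random_hashes m n = Pi_pmf {1..n} 0 (\<lambda>_. pmf_of_set {1..m})"

text \<open>The laws of \<open>d(\<T>\<^sub>m\<^sub>,\<^sub>n)\<close>: \<open>pair_pmf\<close> makes the index uniform and independent of the table.\<close>

definition d_item :: "policy \<Rightarrow> nat \<Rightarrow> nat \<Rightarrow> nat pmf" where
  "d_item pol m n =
    map_pmf (\<lambda>(h, i). displacement pol m n h i) (pair_pmf (random_hashes m n) (pmf_of_set {1..n}))"

definition d_unsuccessful :: "policy \<Rightarrow> nat \<Rightarrow> nat \<Rightarrow> nat pmf" where
  "d_unsuccessful pol m n =
    map_pmf (\<lambda>(h, j). unsuccessful pol m n h j) (pair_pmf (random_hashes m n) (pmf_of_set {1..m}))"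

definition expected :: "nat pmf \<Rightarrow> real" where
  "expected D = measure_pmf.expectation D real"


section \<open>The limit laws\<close>

text \<open>For \<open>\<alpha> = 0\<close> the value \<open>0\<close> for \<open>k \<ge> 1\<close> results from \<open>1 / 0 = 0\<close>.\<close>

definition p_U :: "real \<Rightarrow> nat \<Rightarrow> real" where
  "p_U \<alpha> k = (if k = 0 then 1 - \<alpha>
     else integral {0..\<alpha>} (\<lambda>t. (1 - \<alpha> + t) * (1 - exp (- t)) ^ (k - 1)))"

definition p_L :: "real \<Rightarrow> nat \<Rightarrow> real" where
  "p_L \<alpha> k = (if k = 0 then 1 - \<alpha> / 2
     else 1 / \<alpha> * integral {0..\<alpha>} (\<lambda>t. (\<alpha> - t - (\<alpha> - t)\<^sup>2 / 2) * (1 - exp (- t)) ^ (k - 1)))"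

definition p_E :: "real \<Rightarrow> nat \<Rightarrow> real" where
  "p_E \<alpha> k = (if k = 0 then 1 - \<alpha> / 2
     else 1 / \<alpha> * integral {0..\<alpha>} (\<lambda>t. (\<alpha> - t) * exp (- t) * (1 - exp (- t)) ^ (k - 1)))"

definition D_U :: "real \<Rightarrow> nat pmf" where "D_U \<alpha> = embed_pmf (p_U \<alpha>)"
definition D_L :: "real \<Rightarrow> nat pmf" where "D_L \<alpha> = embed_pmf (p_L \<alpha>)"
definition D_E :: "real \<Rightarrow> nat pmf" where "D_E \<alpha> = embed_pmf (p_E \<alpha>)"

text \<open>An expression in \<open>\<alpha>\<close> that is to be read as its limit (as \<open>\<alpha> \<rightarrow> 0\<close>) at \<open>\<alpha> = 0\<close>.\<close>

definition limit_at_0 :: "(real \<Rightarrow> real) \<Rightarrow> real \<Rightarrow> real" where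
  "limit_at_0 f \<alpha> = (if \<alpha> = 0 then Lim (at_right 0) f else f \<alpha>)"


text \<open>The functions above are probability mass functions, so \<open>D_U\<close>, \<open>D_L\<close>, \<open>D_E\<close> have the
  intended laws.\<close>

lemma pmf_embed_pmf_sums:
  fixes p :: "nat \<Rightarrow> real"
  assumes "\<And>k. 0 \<le> p k" "p sums 1"
  shows "pmf (embed_pmf p) k = p k"
proof (rule pmf_embed_pmf)
  have "(\<integral>\<^sup>+ x. ennreal (p x) \<partial>count_space UNIV) = (\<Sum>k. ennreal (p k))"
    by (rule nn_integral_count_space_nat)
  also have "\<dots> = ennreal (\<Sum>k. p k)"
    using assms by (intro suminf_ennreal2) (auto simp: sums_iff)
  finally show "(\<integral>\<^sup>+ x. ennreal (p x) \<partial>count_space UNIV) = 1"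
    using assms by (simp add: sums_iff)
qed (use assms in auto)

lemma integral_geometric_sums:
  fixes g G :: "real \<Rightarrow> real"
  assumes \<alpha>: "0 \<le> \<alpha>" and g: "continuous_on {0..\<alpha>} g" "\<And>t. t \<in> {0..\<alpha>} \<Longrightarrow> 0 \<le> g t"
    and G: "\<And>t. t \<in> {0..\<alpha>} \<Longrightarrow> (G has_real_derivative g t * exp t) (at t)"
  shows "(\<lambda>k. integral {0..\<alpha>} (\<lambda>t. g t * (1 - exp (- t)) ^ k)) sums (G \<alpha> - G 0)"
proof -
  let ?q = "\<lambda>t::real. 1 - exp (- t)"
  have int: "(\<lambda>t. g t * ?q t ^ k) integrable_on {0..\<alpha>}" for k
    by (intro integrable_continuous_interval continuous_intros g)
  have "(\<lambda>n. integral {0..\<alpha>} (\<lambda>t. \<Sum>k<n. g t * ?q t ^ k))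
          \<longlonglongrightarrow> integral {0..\<alpha>} (\<lambda>t. g t * exp t)"
  proof (rule dominated_convergence)
    show "(\<lambda>t. \<Sum>k<n. g t * ?q t ^ k) integrable_on {0..\<alpha>}" for n
      by (intro integrable_sum int) auto
    show "(\<lambda>t. g t * exp t) integrable_on {0..\<alpha>}"
      by (intro integrable_continuous_interval continuous_intros g)
  next
    fix n t assume t: "t \<in> {0..\<alpha>}"
    have q: "0 \<le> ?q t" "?q t < 1" using t by auto
    have "(\<lambda>k. ?q t ^ k) sums (1 / (1 - ?q t))"
      using q by (intro geometric_sums) auto
    then have s: "(\<lambda>k. g t * ?q t ^ k) sums (g t * exp t)"
      by (intro sums_mult) (simp add: exp_minus field_simps)
    then show "(\<lambda>n. \<Sum>k<n. g t * ?q t ^ k) \<longlonglongrightarrow> g t * exp t"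
      by (simp add: sums_def)
    have nn: "0 \<le> g t * ?q t ^ k" for k
      using g(2)[OF t] q by simp
    have "(\<Sum>k<n. g t * ?q t ^ k) \<le> g t * exp t"
      using sum_le_suminf[of "\<lambda>k. g t * ?q t ^ k" "{..<n}"] s nn by (simp add: sums_iff)
    then show "norm (\<Sum>k<n. g t * ?q t ^ k) \<le> g t * exp t"
      using sum_nonneg[of "{..<n}" "\<lambda>k. g t * ?q t ^ k"] nn by simp
  qed
  moreover have "((\<lambda>t. g t * exp t) has_integral G \<alpha> - G 0) {0..\<alpha>}"
    using \<alpha> G by (intro fundamental_theorem_of_calculus)
      (auto simp: has_real_derivative_iff_has_vector_derivative[symmetric]
            intro: has_field_derivative_at_within)
  ultimately show ?thesis
    using int by (simp add: sums_def integral_sum integral_unique)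
qed

lemma integral_geometric_nonneg:
  fixes g :: "real \<Rightarrow> real"
  assumes "\<And>t. t \<in> {0..\<alpha>} \<Longrightarrow> 0 \<le> g t"
  shows "0 \<le> integral {0..\<alpha>} (\<lambda>t. g t * (1 - exp (- t)) ^ k)"
  using assms by (cases "(\<lambda>t. g t * (1 - exp (- t)) ^ k) integrable_on {0..\<alpha>}")
    (auto intro!: integral_nonneg simp: not_integrable_integral)

lemma quadratic_nonneg:
  fixes s :: real
  assumes "0 \<le> s" "s \<le> 1"
  shows "0 \<le> s - s\<^sup>2 / 2"
  using mult_left_mono[OF assms(2,1)] assms by (simp add: power2_eq_square)

lemma pmf_D_U:
  assumes "\<alpha> \<in> {0..1}"
  shows "pmf (D_U \<alpha>) k = p_U \<alpha> k"
  unfolding D_U_def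
proof (rule pmf_embed_pmf_sums)
  show "0 \<le> p_U \<alpha> k" for k
    using assms by (auto simp: p_U_def intro!: integral_geometric_nonneg)
  have "(\<lambda>k. integral {0..\<alpha>} (\<lambda>t. (1 - \<alpha> + t) * (1 - exp (- t)) ^ k))
          sums ((\<alpha> - \<alpha>) * exp \<alpha> - (0 - \<alpha>) * exp 0)"
    by (rule integral_geometric_sums[where G = "\<lambda>t. (t - \<alpha>) * exp t"])
      (use assms in \<open>auto intro!: continuous_intros derivative_eq_intros simp: algebra_simps\<close>)
  then have "(\<lambda>k. p_U \<alpha> (Suc k)) sums \<alpha>"
    by (simp add: p_U_def)
  then show "p_U \<alpha> sums 1"
    by (subst (asm) sums_Suc_iff) (simp add: p_U_def)
qed

lemma pmf_D_L:
  assumes "\<alpha> \<in> {0..1}"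
  shows "pmf (D_L \<alpha>) k = p_L \<alpha> k"
  unfolding D_L_def
proof (rule pmf_embed_pmf_sums)
  show "0 \<le> p_L \<alpha> k" for k
    using assms by (auto simp: p_L_def
        intro!: integral_geometric_nonneg quadratic_nonneg divide_nonneg_nonneg)
  have "(\<lambda>k. integral {0..\<alpha>} (\<lambda>t. (\<alpha> - t - (\<alpha> - t)\<^sup>2 / 2) * (1 - exp (- t)) ^ k))
          sums (- ((\<alpha> - \<alpha>)\<^sup>2 / 2 * exp \<alpha>) - - ((\<alpha> - 0)\<^sup>2 / 2 * exp 0))"
  proof (rule integral_geometric_sums[where G = "\<lambda>t. - ((\<alpha> - t)\<^sup>2 / 2 * exp t)"])
    show "0 \<le> \<alpha> - t - (\<alpha> - t)\<^sup>2 / 2" if "t \<in> {0..\<alpha>}" for t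
      using that assms by (intro quadratic_nonneg) auto
  qed (use assms in \<open>auto intro!: continuous_intros derivative_eq_intros
         simp: field_simps power2_eq_square\<close>)
  then have "(\<lambda>k. 1 / \<alpha> * integral {0..\<alpha>} (\<lambda>t. (\<alpha> - t - (\<alpha> - t)\<^sup>2 / 2) * (1 - exp (- t)) ^ k))
          sums (1 / \<alpha> * (\<alpha>\<^sup>2 / 2))"
    by (intro sums_mult) simp
  then have "(\<lambda>k. p_L \<alpha> (Suc k)) sums (\<alpha> / 2)"
    by (simp add: p_L_def power2_eq_square)
  then show "p_L \<alpha> sums 1"
    by (subst (asm) sums_Suc_iff) (simp add: p_L_def)
qed

lemma pmf_D_E:
  assumes "\<alpha> \<in> {0..1}"
  shows "pmf (D_E \<alpha>) k = p_E \<alpha> k"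
  unfolding D_E_def
proof (rule pmf_embed_pmf_sums)
  show "0 \<le> p_E \<alpha> k" for k
    using assms by (auto simp: p_E_def intro!: integral_geometric_nonneg divide_nonneg_nonneg)
  have "(\<lambda>k. integral {0..\<alpha>} (\<lambda>t. (\<alpha> - t) * exp (- t) * (1 - exp (- t)) ^ k))
          sums (- ((\<alpha> - \<alpha>)\<^sup>2 / 2) - - ((\<alpha> - 0)\<^sup>2 / 2))"
    by (rule integral_geometric_sums[where G = "\<lambda>t. - ((\<alpha> - t)\<^sup>2 / 2)"])
      (use assms in \<open>auto intro!: continuous_intros derivative_eq_intros
         simp: exp_minus field_simps\<close>)
  then have "(\<lambda>k. 1 / \<alpha> * integral {0..\<alpha>} (\<lambda>t. (\<alpha> - t) * exp (- t) * (1 - exp (- t)) ^ k))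
          sums (1 / \<alpha> * (\<alpha>\<^sup>2 / 2))"
    by (intro sums_mult) simp
  then have "(\<lambda>k. p_E \<alpha> (Suc k)) sums (\<alpha> / 2)"
    by (simp add: p_E_def power2_eq_square)
  then show "p_E \<alpha> sums 1"
    by (subst (asm) sums_Suc_iff) (simp add: p_E_def)
qed

end

theory Submission
  imports Defs
begin

text \<open>
  Call a cell \<open>d\<close> reachable from \<open>c\<close> if following links leads from \<open>c\<close> to \<open>d\<close>; on the occupied
  cells this is a partial order whose comparability classes are the chains.  Let \<open>S\<close> be the number
  of reachable pairs of occupied cells, so that an unsuccessful search has mean \<open>S / m\<close> in a fixed
  table, and let \<open>D\<close> be the sum of the displacements of all items.  Inserting an item with address \<open>a\<close>
  in an occupied cell puts one new cell into the order.  Both policies create one new pair for each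
  cell in the chain of \<open>a\<close>, and one for the new cell itself.  Under late insertion the only new
  displacement is that of the new item, the number of cells reachable from \<open>a\<close>; under early insertion
  it is \<open>1\<close>, and each search path that uses the link out of \<open>a\<close> becomes longer by one.  Summation over
  the \<open>m\<close> values of \<open>a\<close> gives linear recursions for the expectations,
  \<open>S\<^sub>n\<^sub>+\<^sub>1 = (1 + 2 / m) S\<^sub>n + 1 - n / m\<close>, \<open>D\<^sub>n\<^sub>+\<^sub>1 = D\<^sub>n + S\<^sub>n / m\<close> (late) and
  \<open>D\<^sub>n\<^sub>+\<^sub>1 = (1 + 1 / m) D\<^sub>n + n / m\<close> (early), whose explicit solutions converge to the stated limits.
  The means of the limit laws follow from \<open>\<Sum>k. (k + 1) (1 - exp (- t))\<^sup>k = exp (2 t)\<close>.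
\<close>

section \<open>Adding a point to a union of paths\<close>

text \<open>No edge leaves \<open>j\<close>, so the new edge can only be the last one of a
  path.\<close>

lemma rtrancl_insert_fresh:
  assumes "j \<notin> Domain r"
  shows "(insert (e, j) r)\<^sup>* = r\<^sup>* \<union> {x. (x, e) \<in> r\<^sup>*} \<times> {j}"
  using assms unfolding rtrancl_insert by (auto simp: Not_Domain_rtrancl)

lemma acyclic_insert_fresh:
  assumes "acyclic r" "j \<notin> Domain r" "e \<noteq> j"
  shows "acyclic (insert (e, j) r)"
  using assms by (simp add: acyclic_insert Not_Domain_rtrancl)

lemma rtrancl_acyclic_antisym:
  assumes "acyclic r" "(x, y) \<in> r\<^sup>*" "(y, x) \<in> r\<^sup>*"
  shows "x = y"
  using acyclic_impl_antisym_rtrancl[OF assms(1)] assms(2,3) by (auto dest: antisymD)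

text \<open>Single-valuedness forces every nontrivial path from \<open>a\<close> to begin with the
  edge to \<open>k\<close>, and acyclicity prevents \<open>k\<close> from leading back to
  \<open>a\<close>.\<close>

lemma successor_rtrancl_iff:
  assumes "acyclic r" "single_valued r" "(a, k) \<in> r"
  shows "(k, y) \<in> r\<^sup>* \<longleftrightarrow> (a, y) \<in> r\<^sup>* \<and> y \<noteq> a"
proof
  assume "(k, y) \<in> r\<^sup>*"
  then show "(a, y) \<in> r\<^sup>* \<and> y \<noteq> a"
    using assms(1,3) by (metis acyclic_def converse_rtrancl_into_rtrancl rtrancl_into_trancl2)
next
  assume "(a, y) \<in> r\<^sup>* \<and> y \<noteq> a"
  then show "(k, y) \<in> r\<^sup>*"
    using assms(2,3) by (metis converse_rtranclE single_valuedD)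
qed

section \<open>Splicing a new point into an edge\<close>

context
  fixes r :: "('a \<times> 'a) set" and a k j
  assumes acyc: "acyclic r" and sv: "single_valued r" and ak: "(a, k) \<in> r"
    and fresh: "j \<notin> Field r"
begin

text \<open>Old and spliced relation both extend \<open>r - {(a, k)}\<close>; describing the closure
  of \<open>r\<close> over this common base makes them comparable.\<close>

private lemma decomp:
  "r\<^sup>* = (r - {(a, k)})\<^sup>* \<union> {(x, y). (x, a) \<in> (r - {(a, k)})\<^sup>* \<and> (k, y) \<in> (r - {(a, k)})\<^sup>*}"
  using rtrancl_insert[of a k "r - {(a, k)}"] ak by (simp add: insert_absorb)

private lemma no_back: "(k, a) \<notin> (r - {(a, k)})\<^sup>*"
  using successor_rtrancl_iff[OF acyc sv ak, of a] decomp by auto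

private lemma jump:
  "(insert (a, j) (r - {(a, k)}))\<^sup>* = (r - {(a, k)})\<^sup>* \<union> {x. (x, a) \<in> (r - {(a, k)})\<^sup>*} \<times> {j}"
  using fresh by (intro rtrancl_insert_fresh) (auto simp: Field_def)

private lemma to_j: "(x, j) \<in> (r - {(a, k)})\<^sup>* \<longleftrightarrow> x = j"
  using fresh by (auto simp: Field_def elim: rtranclE)

text \<open>The detour through \<open>j\<close> replaces the lost edge, so no old reachability
  disappears. The point \<open>j\<close> inherits the predecessors of \<open>a\<close>, with
  \<open>a\<close> itself, and whatever \<open>k\<close> reaches, which is everything properly after
  \<open>a\<close>.\<close>

lemma rtrancl_splice:
  "(insert (j, k) (insert (a, j) (r - {(a, k)})))\<^sup>*
    = r\<^sup>* \<union> {x. (x, a) \<in> r\<^sup>*} \<times> {j} \<union> {j} \<times> {y. (a, y) \<in> r\<^sup>* \<and> y \<noteq> a}"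
proof -
  have "(x, a) \<in> r\<^sup>* \<longleftrightarrow> (x, a) \<in> (r - {(a, k)})\<^sup>*"
       "(k, x) \<in> r\<^sup>* \<longleftrightarrow> (k, x) \<in> (r - {(a, k)})\<^sup>*" for x
    using decomp no_back by auto
  then show ?thesis
    unfolding successor_rtrancl_iff[OF acyc sv ak, symmetric] rtrancl_insert[of j k] jump
    using decomp no_back to_j by auto
qed

lemma acyclic_splice: "acyclic (insert (j, k) (insert (a, j) (r - {(a, k)})))"
proof -
  have "a \<noteq> j" "k \<noteq> j" using fresh ak by (auto simp: Field_def)
  moreover have "acyclic (insert (a, j) (r - {(a, k)}))"
    using fresh \<open>a \<noteq> j\<close> by (intro acyclic_insert_fresh acyclic_subset[OF acyc]) (auto simp: Field_def)
  ultimately show ?thesis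
    unfolding acyclic_insert jump using no_back to_j by auto
qed

end

text \<open>The left end is included and the right end excluded, so that on a path the cardinality
  is the number of edges from \<open>x\<close> to \<open>y\<close>. A displacement thus becomes the
  size of a set, to which an insertion adds at most one cell.\<close>

definition between :: "('a \<times> 'a) set \<Rightarrow> 'a \<Rightarrow> 'a \<Rightarrow> 'a set" where
  "between r x y = {z. (x, z) \<in> r\<^sup>* \<and> (z, y) \<in> r\<^sup>* \<and> z \<noteq> y}"

text \<open>Removing the first edge of the path removes exactly \<open>x\<close> from the set. In
  particular all paths from \<open>x\<close> to \<open>y\<close> have the same length.\<close>

lemma card_between:
  assumes "acyclic r" "single_valued r" "(x, y) \<in> r ^^ k"
  shows "finite (between r x y) \<and> card (between r x y) = k"
  using assms(3)
proof (induction k arbitrary: x)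
  case 0
  then have "between r x y = {}"
    using rtrancl_acyclic_antisym[OF assms(1)] by (auto simp: between_def)
  then show ?case by simp
next
  case (Suc k)
  then obtain z where z: "(x, z) \<in> r" "(z, y) \<in> r ^^ k"
    by (meson relpow_Suc_D2)
  then have "(z, y) \<in> r\<^sup>*" by (auto simp: rtrancl_power)
  then have "x \<noteq> y"  "(x, y) \<in> r\<^sup>*"
    using successor_rtrancl_iff[OF assms(1,2) z(1), of y] by auto
  then have "between r x y = insert x (between r z y)" "x \<notin> between r z y"
    using successor_rtrancl_iff[OF assms(1,2) z(1)] by (auto simp: between_def)
  then show ?case using Suc.IH[OF z(2)] by simp
qed

section \<open>Chains in a hash table\<close>

definition links :: "hash_table \<Rightarrow> (nat \<times> nat) set" where
  "links T = {(c, d). link T c = Some d}"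

lemma single_valued_links: "single_valued (links T)"
  by (auto simp: links_def single_valued_def)

lemma follow_eq_Some_iff: "follow T c k = Some d \<longleftrightarrow> (c, d) \<in> links T ^^ k"
proof (induction k arbitrary: d)
  case (Suc k)
  have "follow T c (Suc k) = Some d \<longleftrightarrow> (\<exists>b. follow T c k = Some b \<and> (b, d) \<in> links T)"
    by (auto simp: links_def split: option.splits)
  also have "\<dots> \<longleftrightarrow> (c, d) \<in> links T ^^ Suc k"
    unfolding Suc.IH by auto
  finally show ?case .
qed auto

text \<open>Only one \<open>k\<close> qualifies, by \<open>card_between\<close>, so the
  \<open>LEAST\<close> involves no minimization.\<close>

lemma Least_follow_eq_card_between:
  assumes "acyclic (links T)" "(c, d) \<in> (links T)\<^sup>*"
  shows "(LEAST k. follow T c k = Some d) = card (between (links T) c d)"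
proof -
  have "k = card (between (links T) c d)" if "(c, d) \<in> links T ^^ k" for k
    using card_between[OF assms(1) single_valued_links that] by simp
  moreover obtain k where "(c, d) \<in> links T ^^ k"
    using assms(2) by (auto simp: rtrancl_power)
  ultimately show ?thesis
    unfolding follow_eq_Some_iff by (metis (mono_tags, lifting) LeastI_ex)
qed

definition occupied :: "hash_table \<Rightarrow> nat set" where
  "occupied T = dom (item T)"

text \<open>The closure is reflexive, so each occupied cell is paired with itself, in accordance
  with the \<open>1 +\<close> in \<open>unsuccessful\<close>. The restriction discards the reflexive
  pairs of all other numbers.\<close>

definition reach_pairs :: "hash_table \<Rightarrow> nat" where
  "reach_pairs T = card ((links T)\<^sup>* \<inter> occupied T \<times> occupied T)"

definition total_displacement :: "(nat \<Rightarrow> nat) \<Rightarrow> hash_table \<Rightarrow> nat" where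
  "total_displacement h T = (\<Sum>p\<in>occupied T. card (between (links T) (h (the (item T p))) p))"

text \<open>The invariant of the construction. Together with \<open>single_valued_links\<close> it
  makes the links a disjoint union of finite paths, and \<open>home_reaches_item\<close> ensures
  that every search for a stored item succeeds.\<close>

locale coalesced_table =
  fixes m n :: nat and h :: "nat \<Rightarrow> nat" and T :: hash_table
  assumes occupied_cells: "occupied T \<subseteq> {1..m}"
    and inj_item: "inj_on (item T) (occupied T)"
    and ran_item: "ran (item T) = {1..n}"
    and links_occupied: "Field (links T) \<subseteq> occupied T"
    and single_valued_converse_links: "single_valued ((links T)\<inverse>)"
    and acyclic_links: "acyclic (links T)"
    and home_reaches_item: "item T p = Some i \<Longrightarrow> (h i, p) \<in> (links T)\<^sup>*"
begin

abbreviation occ where "occ \<equiv> occupied T"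
abbreviation R where "R \<equiv> (links T)\<^sup>*"

lemma finite_occupied: "finite occ"
  using finite_subset[OF occupied_cells] by simp

lemma card_occupied: "card occ = n"
proof -
  have "item T ` occ = Some ` ran (item T)"
    by (force simp: ran_def occupied_def)
  then show ?thesis
    using card_image[OF inj_item] by (simp add: card_image ran_item)
qed

lemma reach_occupied: "(c, d) \<in> R \<Longrightarrow> c \<in> occ \<longleftrightarrow> d \<in> occ"
  by (induction rule: rtrancl_induct) (use links_occupied in \<open>auto simp: Field_def\<close>)

lemma reach_empty: "j \<notin> occ \<Longrightarrow> (j, c) \<in> R \<longleftrightarrow> c = j" "j \<notin> occ \<Longrightarrow> (c, j) \<in> R \<longleftrightarrow> c = j"
  using links_occupied by (blast elim: converse_rtranclE rtranclE intro: FieldI1 FieldI2)+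

lemma chain_end:
  "(c, chain_end T c) \<in> R" "link T (chain_end T c) = None"
proof -
  have "finite (links T)"
    using links_occupied finite_occupied
    by (auto simp: Field_def intro!: finite_subset[where A = "links T" and B = "occ \<times> occ"])
  \<comment> \<open>A finite acyclic relation admits no infinite walk along the links, so some cell
    with a null link is reached and the \<open>LEAST\<close> in \<open>chain_end\<close>
    exists.\<close>
  then have "wf ((links T)\<inverse>)"
    using acyclic_links by (simp add: finite_acyclic_wf_converse)
  then have "\<exists>e. (c, e) \<in> R \<and> link T e = None"
  proof (induction c)
    case (less c)
    show ?case
    proof (cases "link T c")
      case (Some d)
      then show ?thesis
        using less[of d] by (auto simp: links_def intro: converse_rtrancl_into_rtrancl)
    qed auto
  qed
  then obtain e' k where "follow T c k = Some e'" "link T e' = None"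
    by (auto simp: rtrancl_power follow_eq_Some_iff[symmetric])
  then have "follow T c (Suc k) = None" by simp
  define K where "K = (LEAST k. follow T c (Suc k) = None)"
  have K: "follow T c (Suc K) = None"
    unfolding K_def using \<open>follow T c (Suc k) = None\<close> by (rule LeastI)
  \<comment> \<open>For positive \<open>K\<close>, a failure here would already satisfy the defining
    condition at \<open>K - 1\<close>.\<close>
  have "follow T c K \<noteq> None"
  proof (cases K)
    case (Suc l)
    then show ?thesis using not_less_Least[of l "\<lambda>k. follow T c (Suc k) = None"] K_def by auto
  qed simp
  then obtain e where e: "follow T c K = Some e" by auto
  then have "chain_end T c = e" by (simp add: chain_end_def K_def)
  then show "(c, chain_end T c) \<in> R" "link T (chain_end T c) = None"
    using e K by (auto simp: rtrancl_power follow_eq_Some_iff[symmetric] simp del: follow.simps)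
      (simp add: follow.simps)
qed


definition below where "below c = {d. (d, c) \<in> R}"
definition above where "above c = {d. (c, d) \<in> R}"

lemma below_above_occupied: "c \<in> occ \<Longrightarrow> below c \<subseteq> occ" "c \<in> occ \<Longrightarrow> above c \<subseteq> occ"
  using reach_occupied by (auto simp: below_def above_def)

lemma finite_below_above: "c \<in> occ \<Longrightarrow> finite (below c)" "c \<in> occ \<Longrightarrow> finite (above c)"
  by (rule finite_subset[OF _ finite_occupied], erule below_above_occupied)+

lemma sum_card_above: "(\<Sum>c\<in>occ. card (above c)) = reach_pairs T"
proof -
  have "R \<inter> occ \<times> occ = Sigma occ above"
    using below_above_occupied(2) by (fastforce simp: above_def)
  then show ?thesis
    unfolding reach_pairs_def using finite_occupied finite_below_above by simp
qed

text \<open>The pairs of \<open>sum_card_above\<close> are now counted by their second component.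
  The equality of the two sums is the source of the coefficient \<open>2 / m\<close> in the
  recursion for \<open>reach_pairs\<close>.\<close>

lemma sum_card_below: "(\<Sum>c\<in>occ. card (below c)) = reach_pairs T"
proof -
  have "R \<inter> occ \<times> occ = prod.swap ` Sigma occ below"
    using below_above_occupied by (force simp: below_def)
  then show ?thesis
    unfolding reach_pairs_def using finite_occupied finite_below_above
    by (simp add: card_image[OF inj_swap])
qed

end

section \<open>Inserting an item\<close>

text \<open>The new cell \<open>j\<close> becomes reachable from the cells in \<open>A\<close> and reaches those in \<open>B\<close>.  An insertion
  at an empty address \<open>a\<close> is the case \<open>j = a\<close>, \<open>A = B = {}\<close>.\<close>

locale item_insertion = coalesced_table +
  fixes T' :: hash_table and j :: nat and A B :: "nat set"
  assumes new_cell: "j \<in> {1..m}" "j \<notin> occ"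
    and item_insert: "item T' = (item T)(j := Some (Suc n))"
    and Field_insert: "Field (links T') \<subseteq> insert j occ"
    and single_valued_insert: "single_valued ((links T')\<inverse>)"
    and acyclic_insert: "acyclic (links T')"
    and reach_insert: "(links T')\<^sup>* = R \<union> A \<times> {j} \<union> {j} \<times> B"
    and AB_occupied: "A \<subseteq> occ" "B \<subseteq> occ"
begin

lemma occupied_insert: "occupied T' = insert j occ"
  by (simp add: item_insert occupied_def)

text \<open>The premise says that the address of the new item reaches the new cell, which is what
  \<open>home_reaches_item\<close> demands of that item.\<close>

lemma coalesced_table_insert:
  assumes "a = j \<or> a \<in> A"
  shows "coalesced_table m (Suc n) (h(Suc n := a)) T'"
proof
  show "occupied T' \<subseteq> {1..m}"
    using occupied_cells new_cell by (simp add: occupied_insert)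
  have new: "item T p \<noteq> Some (Suc n)" for p
    using ran_item by (metis Suc_n_not_le_n atLeastAtMost_iff ranI)
  show "inj_on (item T') (occupied T')"
  proof -
    have "Some (Suc n) \<notin> item T ` S" for S
      using new by (metis imageE)
    then show ?thesis
      unfolding occupied_insert item_insert inj_on_insert
      using new_cell(2) by (simp add: inj_on_fun_updI inj_item)
  qed
  show "ran (item T') = {1..Suc n}"
    using new_cell ran_item by (auto simp: item_insert occupied_def domIff)
  show "Field (links T') \<subseteq> occupied T'" "single_valued ((links T')\<inverse>)" "acyclic (links T')"
    using Field_insert single_valued_insert acyclic_insert by (simp_all add: occupied_insert)
  show "((h(Suc n := a)) i, p) \<in> (links T')\<^sup>*" if "item T' p = Some i" for p i
  proof (cases "p = j")
    case True
    then show ?thesis using that assms reach_insert by (auto simp: item_insert)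
  next
    case False
    then show ?thesis using that new home_reaches_item reach_insert by (auto simp: item_insert)
  qed
qed

text \<open>As \<open>j\<close> is fresh, the new pairs split into \<open>A \<times> {j}\<close>,
  \<open>{j} \<times> B\<close> and the single pair \<open>(j, j)\<close>.\<close>

lemma reach_pairs_insert: "reach_pairs T' = reach_pairs T + card A + card B + 1"
proof -
  have "(links T')\<^sup>* \<inter> occupied T' \<times> occupied T'
      = (R \<inter> occ \<times> occ) \<union> (A \<times> {j} \<union> ({j} \<times> B \<union> {(j, j)}))"
    using new_cell reach_empty AB_occupied unfolding occupied_insert reach_insert by blast
  moreover have "finite A" "finite B" "j \<notin> A" "j \<notin> B"
    using AB_occupied new_cell(2) finite_subset[OF _ finite_occupied] by blast+
  moreover have "(R \<inter> occ \<times> occ) \<inter> (A \<times> {j} \<union> ({j} \<times> B \<union> {(j, j)})) = {}"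
    "A \<times> {j} \<inter> ({j} \<times> B \<union> {(j, j)}) = {}" "({j} \<times> B) \<inter> {(j, j)} = {}"
    using new_cell(2) \<open>j \<notin> A\<close> \<open>j \<notin> B\<close> by auto
  ultimately show ?thesis
    using finite_occupied by (simp add: card_Un_disjoint card_cartesian_product reach_pairs_def)
qed

text \<open>Reachability among old cells is unchanged, so \<open>j\<close> is the only possible new
  member.\<close>

lemma between_insert_old:
  assumes "x \<in> occ" "y \<in> occ"
  shows "between (links T') x y
      = between (links T) x y \<union> (if x \<in> A \<and> y \<in> B then {j} else {})"
  using assms new_cell AB_occupied reach_empty unfolding between_def reach_insert by auto

lemma between_insert_new:
  assumes "a = j \<or> a \<in> A"
  shows "between (links T') a j = (if a = j then {} else A \<inter> above a)"
proof (cases "a = j")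
  case True
  then show ?thesis
    using rtrancl_acyclic_antisym[OF acyclic_insert] by (auto simp: between_def)
next
  case False
  then have "a \<in> A" using assms by simp
  have "z \<noteq> j \<Longrightarrow> (z, j) \<in> (links T')\<^sup>* \<longleftrightarrow> z \<in> A"
    "z \<noteq> j \<Longrightarrow> (a, z) \<in> (links T')\<^sup>* \<longleftrightarrow> (a, z) \<in> R" for z
    unfolding reach_insert using reach_empty(2)[OF new_cell(2)] False by auto
  moreover have "z \<in> A \<Longrightarrow> z \<noteq> j" for z using new_cell(2) AB_occupied by auto
  ultimately have "z \<in> between (links T') a j \<longleftrightarrow> z \<in> A \<inter> above a" for z
    unfolding between_def above_def by (cases "z = j") auto
  then show ?thesis using False by auto
qed

text \<open>The second summand is the displacement of the new item. The third counts the old items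
  whose search path now passes through \<open>j\<close>: they start in \<open>A\<close> and are
  stored in \<open>B\<close>, and each becomes longer by one.\<close>

lemma total_displacement_insert:
  assumes "a = j \<or> a \<in> A"
  shows "total_displacement (h(Suc n := a)) T' = total_displacement h T + (if a = j then 0 else card (A \<inter> above a))
      + card {p \<in> B. h (the (item T p)) \<in> A}"
proof -
  \<comment> \<open>An old address reaches an occupied cell and is therefore occupied; old indices
    are at most \<open>n\<close>, so updating \<open>h\<close> at \<open>Suc n\<close> leaves old
    addresses alone.\<close>
  have home: "h (the (item T p)) \<in> occ" "the (item T p) \<noteq> Suc n" if "p \<in> occ" for p
  proof -
    from that obtain i where i: "item T p = Some i" by (auto simp: occupied_def)
    then have "i \<in> {1..n}" using ran_item by (metis ranI)
    then show "h (the (item T p)) \<in> occ" "the (item T p) \<noteq> Suc n"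
      using reach_occupied[OF home_reaches_item[OF i]] that i by auto
  qed
  define Q where "Q = {p \<in> B. h (the (item T p)) \<in> A}"
  have "Q \<subseteq> occ" using AB_occupied by (auto simp: Q_def)
  have old: "card (between (links T') ((h(Suc n := a)) (the (item T' p))) p)
      = card (between (links T) (h (the (item T p))) p) + (if p \<in> Q then 1 else 0)"
    if p: "p \<in> occ" for p
  proof -
    have "between (links T) (h (the (item T p))) p \<subseteq> occ"
      using p reach_occupied by (auto simp: between_def)
    then have "j \<notin> between (links T) (h (the (item T p))) p"
        "finite (between (links T) (h (the (item T p))) p)"
      using new_cell(2) finite_subset[OF _ finite_occupied] by blast+
    moreover have "item T' p = item T p"
      using p new_cell by (auto simp: item_insert)
    ultimately show ?thesis
      using between_insert_old[OF home(1)[OF p] p] home(2)[OF p] p AB_occupied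
      by (auto simp: Q_def)
  qed
  have "total_displacement (h(Suc n := a)) T' = card (between (links T') a j)
       + (\<Sum>p\<in>occ. card (between (links T') ((h(Suc n := a)) (the (item T' p))) p))"
    unfolding total_displacement_def occupied_insert
    using new_cell(2) finite_occupied by (simp add: item_insert)
  also have "(\<Sum>p\<in>occ. card (between (links T') ((h(Suc n := a)) (the (item T' p))) p))
      = (\<Sum>p\<in>occ. card (between (links T) (h (the (item T p))) p) + (if p \<in> Q then 1 else 0))"
    by (rule sum.cong[OF refl old])
  also have "\<dots> = total_displacement h T + card Q"
    using finite_occupied \<open>Q \<subseteq> occ\<close>
    by (simp add: sum.distrib total_displacement_def sum.If_cases Int_absorb1)
  also have "card (between (links T') a j) = (if a = j then 0 else card (A \<inter> above a))"
    by (simp add: between_insert_new[OF assms])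
  finally show ?thesis
    unfolding Q_def by (simp only: ac_simps)
qed

end

section \<open>The two policies as additions of one point\<close>

context coalesced_table
begin

lemma link_empty: "j \<notin> occ \<Longrightarrow> link T j = None"
  using links_occupied by (auto simp: links_def Field_def)

lemma links_empty: "j \<notin> occ \<Longrightarrow> j \<notin> Field (links T)"
  using links_occupied by auto

lemma links_occupied': "(c, d) \<in> links T \<Longrightarrow> c \<in> occ" "(c, d) \<in> links T \<Longrightarrow> d \<in> occ"
  using links_occupied by (auto simp: Field_def)

lemma insert_item_empty:
  assumes "a \<in> {1..m}" "a \<notin> occ"
  shows "item_insertion m n h T (insert_item pol m (Suc n) a T) a {} {}"
proof -
  have "item T a = None" using assms by (auto simp: occupied_def)
  then have "links (insert_item pol m (Suc n) a T) = links T"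
    "item (insert_item pol m (Suc n) a T) = (item T)(a := Some (Suc n))"
    by (auto simp: insert_item_def links_def)
  then show ?thesis
    using assms links_occupied single_valued_converse_links acyclic_links
    by unfold_locales auto
qed

text \<open>Two cells reaching the end are comparable because predecessors are unique. A cell
  reachable from \<open>a\<close> is comparable with the end because successors are unique, and
  nothing lies after the end. Appending there hence makes \<open>j\<close> reachable from the whole
  chain of \<open>a\<close>.\<close>

lemma below_chain_end: "below (chain_end T a) = below a \<union> above a"
proof -
  have "(c, chain_end T a) \<in> R \<Longrightarrow> (c, a) \<in> R \<or> (a, c) \<in> R" for c
  proof -
    assume "(c, chain_end T a) \<in> R"
    then show ?thesis
      using chain_end(1)[of a] single_valued_confluent[OF single_valued_converse_links]
      by (metis rtrancl_converseD rtrancl_converseI)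
  qed
  moreover have "(c, chain_end T a) \<in> R" if "(a, c) \<in> R" for c
  proof -
    have "(c, chain_end T a) \<in> R \<or> (chain_end T a, c) \<in> R"
      using single_valued_confluent[OF single_valued_links that chain_end(1)] .
    moreover have "(chain_end T a, c) \<in> R \<Longrightarrow> c = chain_end T a"
      using chain_end(2)[of a] by (auto simp: links_def elim: converse_rtranclE)
    ultimately show ?thesis by auto
  qed
  ultimately show ?thesis
    using chain_end(1)[of a] by (auto simp: below_def above_def dest: rtrancl_trans)
qed

lemma chain_end_occupied: "a \<in> occ \<Longrightarrow> chain_end T a \<in> occ"
  using reach_occupied[OF chain_end(1)] by simp

lemma below_Int_above: "below a \<inter> above a = {a}"
  using rtrancl_acyclic_antisym[OF acyclic_links] by (auto simp: below_def above_def)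

text \<open>This covers late insertion, with \<open>e\<close> the end of the chain, and early
  insertion at a cell \<open>e\<close> that is the last of its chain.\<close>

lemma append_link:
  assumes "j \<in> {1..m}" "j \<notin> occ" "e \<in> occ" "link T e = None"
    and "item T' = (item T)(j := Some (Suc n))" "links T' = insert (e, j) (links T)"
  shows "item_insertion m n h T T' j (below e) {}"
proof
  have fresh: "j \<notin> Field (links T)" "j \<notin> Domain (links T)"
    using links_empty[OF assms(2)] by (auto simp: Field_def)
  show "Field (links T') \<subseteq> insert j occ"
    using links_occupied assms by (auto simp: Field_def)
  show "single_valued ((links T')\<inverse>)"
    using single_valued_converse_links fresh assms(6)
    by (auto simp: single_valued_def Field_def)
  show "acyclic (links T')"
    unfolding assms(6) using assms fresh acyclic_links by (intro acyclic_insert_fresh) auto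
  show "(links T')\<^sup>* = R \<union> below e \<times> {j} \<union> {j} \<times> {}"
    unfolding assms(6) using rtrancl_insert_fresh[OF fresh(2)] by (simp add: below_def)
qed (use assms below_above_occupied in auto)

lemma splice_link:
  assumes "j \<in> {1..m}" "j \<notin> occ" "(a, k) \<in> links T"
    and "item T' = (item T)(j := Some (Suc n))"
    and "links T' = insert (j, k) (insert (a, j) (links T - {(a, k)}))"
  shows "item_insertion m n h T T' j (below a) (above a - {a})"
proof
  have fresh: "j \<notin> Field (links T)"
    using links_empty[OF assms(2)] .
  show "Field (links T') \<subseteq> insert j occ"
    using links_occupied assms by (auto simp: Field_def)
  show "single_valued ((links T')\<inverse>)"
    using single_valued_converse_links fresh assms(3) unfolding assms(5)
    by (auto simp: single_valued_def Field_def)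
  show "acyclic (links T')"
    unfolding assms(5) by (intro acyclic_splice acyclic_links single_valued_links assms fresh)
  show "(links T')\<^sup>* = R \<union> below a \<times> {j} \<union> {j} \<times> (above a - {a})"
    unfolding assms(5) rtrancl_splice[OF acyclic_links single_valued_links assms(3) fresh]
    by (auto simp: below_def above_def)
qed (use assms below_above_occupied[OF links_occupied'(1)[OF assms(3)]] in auto)

lemma self_below_above: "a \<in> below a" "a \<in> above a"
  by (auto simp: below_def above_def)

lemma sum_split_occupied:
  fixes f :: "nat \<Rightarrow> nat"
  shows "(\<Sum>a\<in>{1..m}. if a \<in> occ then f a else c) = (\<Sum>a\<in>occ. f a) + (m - n) * c"
proof -
  have "{1..m} \<inter> - occ = {1..m} - occ" "{1..m} \<inter> occ = occ" using occupied_cells by auto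
  then show ?thesis
    using occupied_cells finite_occupied
    by (simp add: sum.If_cases card_Diff_subset card_occupied Collect_mem_eq)
qed

section \<open>The effect of one insertion\<close>

context
  assumes not_full: "n < m"
begin

lemma free_cell:
  defines "j \<equiv> Max {c \<in> {1..m}. item T c = None}"
  shows "j \<in> {1..m}" "j \<notin> occ"
proof -
  have "{c \<in> {1..m}. item T c = None} \<noteq> {}"
  proof
    assume "{c \<in> {1..m}. item T c = None} = {}"
    then have "{1..m} \<subseteq> occ" by (auto simp: occupied_def)
    then have "card {1..m} \<le> card occ" by (rule card_mono[OF finite_occupied])
    then show False using not_full by (simp add: card_occupied)
  qed
  then have "j \<in> {c \<in> {1..m}. item T c = None}"
    unfolding j_def by (intro Max_in) auto
  then show "j \<in> {1..m}" "j \<notin> occ" by (auto simp: occupied_def)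
qed

lemma insert_item_Late:
  assumes "a \<in> occ"
  shows "\<exists>j. item_insertion m n h T (insert_item Late m (Suc n) a T) j (below a \<union> above a) {}"
proof -
  define j where "j = Max {c \<in> {1..m}. item T c = None}"
  have "item T a \<noteq> None" using assms by (auto simp: occupied_def)
  then have "item_insertion m n h T (insert_item Late m (Suc n) a T) j (below (chain_end T a)) {}"
    using free_cell chain_end_occupied[OF assms] chain_end(2)[of a]
    by (intro append_link) (auto simp: j_def insert_item_def links_def Let_def split: if_splits)
  then show ?thesis unfolding below_chain_end by blast
qed

lemma insert_item_Early:
  assumes "a \<in> occ"
  shows "\<exists>j. item_insertion m n h T (insert_item Early m (Suc n) a T) j (below a) (above a - {a})"
proof -
  define j where "j = Max {c \<in> {1..m}. item T c = None}"
  define T' where "T' = insert_item Early m (Suc n) a T"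
  have j: "j \<in> {1..m}" "j \<notin> occ" using free_cell by (auto simp: j_def)
  then have "j \<noteq> a" using assms by auto
  have "item T a \<noteq> None" using assms by (auto simp: occupied_def)
  then have T': "item T' = (item T)(j := Some (Suc n))" "link T' = (link T)(j := link T a, a := Some j)"
    by (auto simp: T'_def j_def insert_item_def Let_def)
  show ?thesis
  proof (cases "link T a")
    \<comment> \<open>Here \<open>j\<close> is given the null link that it already has, so the
      insertion is an append at \<open>a\<close>.\<close>
    case None
    then have "above a - {a} = {}"
      by (auto simp: above_def links_def elim: converse_rtranclE)
    moreover have "item_insertion m n h T T' j (below a) {}"
      using j assms None T' link_empty[OF j(2)] by (intro append_link) (auto simp: links_def fun_upd_apply split: if_splits)
    ultimately have "item_insertion m n h T T' j (below a) (above a - {a})" by (simp only:)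
    then show ?thesis unfolding T'_def by blast
  next
    case (Some k)
    then have "item_insertion m n h T T' j (below a) (above a - {a})"
      using j assms T' link_empty[OF j(2)] \<open>j \<noteq> a\<close>
      by (intro splice_link[where k = k]) (auto simp: links_def split: if_splits)
    then show ?thesis unfolding T'_def by auto
  qed
qed

lemma coalesced_table_insert_item:
  assumes "a \<in> {1..m}"
  shows "coalesced_table m (Suc n) (h(Suc n := a)) (insert_item pol m (Suc n) a T)"
proof (cases "a \<in> occ")
  case True
  then show ?thesis
    using insert_item_Late insert_item_Early self_below_above
    by (cases pol) (metis UnI1 item_insertion.coalesced_table_insert)+
next
  case False
  then show ?thesis
    using item_insertion.coalesced_table_insert[OF insert_item_empty[OF assms False]] by simp
qed

text \<open>The policies distribute the chain of \<open>a\<close> differently over \<open>A\<close>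
  and \<open>B\<close>, but in both cases the sizes add up to
  \<open>card (below a) + card (above a) - 1\<close>, since \<open>a\<close> alone lies in both
  sets. The pair \<open>(j, j)\<close> compensates for the \<open>- 1\<close>.\<close>

lemma reach_pairs_insert_item:
  assumes "a \<in> {1..m}"
  shows "reach_pairs (insert_item pol m (Suc n) a T)
    = reach_pairs T + (if a \<in> occ then card (below a) + card (above a) else 1)"
proof (cases "a \<in> occ")
  case True
  note fin = finite_below_above[OF True]
  show ?thesis
  proof (cases pol)
    case Late
    obtain j where "item_insertion m n h T (insert_item Late m (Suc n) a T) j (below a \<union> above a) {}"
      using insert_item_Late[OF True] by blast
    moreover have "card (below a) + card (above a) = card (below a \<union> above a) + 1"
      using card_Un_Int[OF fin] by (simp add: below_Int_above)
    ultimately show ?thesis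
      using True Late item_insertion.reach_pairs_insert by fastforce
  next
    case Early
    obtain j where "item_insertion m n h T (insert_item Early m (Suc n) a T) j (below a) (above a - {a})"
      using insert_item_Early[OF True] by blast
    moreover have "card (above a) = card (above a - {a}) + 1"
      using fin self_below_above by (metis Suc_eq_plus1 card_Suc_Diff1)
    ultimately show ?thesis
      using True Early item_insertion.reach_pairs_insert by fastforce
  qed
next
  case False
  then show ?thesis
    using item_insertion.reach_pairs_insert[OF insert_item_empty[OF assms False]] by simp
qed

lemma total_displacement_insert_empty:
  assumes "a \<in> {1..m}" "a \<notin> occ"
  shows "total_displacement (h(Suc n := a)) (insert_item pol m (Suc n) a T) = total_displacement h T"
  using item_insertion.total_displacement_insert[OF insert_item_empty[OF assms]] by simp

text \<open>With \<open>B\<close> empty no old search path changes, and \<open>A\<close> contains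
  all of \<open>above a\<close>.\<close>

lemma total_displacement_insert_Late:
  assumes "a \<in> occ"
  shows "total_displacement (h(Suc n := a)) (insert_item Late m (Suc n) a T)
    = total_displacement h T + card (above a)"
proof -
  obtain j where j: "item_insertion m n h T (insert_item Late m (Suc n) a T) j (below a \<union> above a) {}"
    using insert_item_Late[OF assms] by blast
  then have "a \<noteq> j" using assms item_insertion.new_cell(2) by blast
  then show ?thesis
    using item_insertion.total_displacement_insert[OF j, of a] self_below_above
    by (simp add: Int_absorb1 Int_Un_distrib2)
qed

text \<open>The sets \<open>below a\<close> and \<open>above a\<close> meet only in
  \<open>a\<close>, so the new item has displacement \<open>1\<close>. As \<open>between\<close>
  excludes its right end, \<open>a\<close> belongs to it exactly when the search path uses the link
  out of \<open>a\<close>.\<close>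

lemma total_displacement_insert_Early:
  assumes "a \<in> occ"
  shows "total_displacement (h(Suc n := a)) (insert_item Early m (Suc n) a T)
    = total_displacement h T + 1 + card {p \<in> occ. a \<in> between (links T) (h (the (item T p))) p}"
proof -
  obtain j where j: "item_insertion m n h T (insert_item Early m (Suc n) a T) j (below a) (above a - {a})"
    using insert_item_Early[OF assms] by blast
  then have "a \<noteq> j" using assms item_insertion.new_cell(2) by blast
  moreover have "{p \<in> above a - {a}. h (the (item T p)) \<in> below a}
      = {p \<in> occ. a \<in> between (links T) (h (the (item T p))) p}"
    using below_above_occupied(2)[OF assms] by (auto simp: between_def below_def above_def)
  ultimately show ?thesis
    using item_insertion.total_displacement_insert[OF j, of a] self_below_above
    by (simp add: below_Int_above)
qed

section \<open>Sums over all addresses of the next item\<close>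

lemma sum_reach_pairs:
  "(\<Sum>a\<in>{1..m}. reach_pairs (insert_item pol m (Suc n) a T)) = (m + 2) * reach_pairs T + (m - n)"
proof -
  have "(\<Sum>a\<in>{1..m}. reach_pairs (insert_item pol m (Suc n) a T))
    = (\<Sum>a\<in>{1..m}. reach_pairs T + (if a \<in> occ then card (below a) + card (above a) else 1))"
    by (intro sum.cong refl reach_pairs_insert_item)
  also have "\<dots> = m * reach_pairs T + ((\<Sum>a\<in>occ. card (below a) + card (above a)) + (m - n) * 1)"
    unfolding sum.distrib[of "\<lambda>_. reach_pairs T"] sum_split_occupied by simp
  finally show ?thesis
    by (simp add: sum.distrib sum_card_below sum_card_above algebra_simps)
qed

lemma sum_total_displacement_Late:
  "(\<Sum>a\<in>{1..m}. total_displacement (h(Suc n := a)) (insert_item Late m (Suc n) a T))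
    = m * total_displacement h T + reach_pairs T"
proof -
  have "(\<Sum>a\<in>{1..m}. total_displacement (h(Suc n := a)) (insert_item Late m (Suc n) a T))
    = (\<Sum>a\<in>{1..m}. total_displacement h T + (if a \<in> occ then card (above a) else 0))"
    by (intro sum.cong refl)
      (simp add: total_displacement_insert_empty total_displacement_insert_Late)
  then show ?thesis
    unfolding sum.distrib[of "\<lambda>_. total_displacement h T"] sum_split_occupied
    by (simp add: sum_card_above)
qed

lemma sum_total_displacement_Early:
  "(\<Sum>a\<in>{1..m}. total_displacement (h(Suc n := a)) (insert_item Early m (Suc n) a T))
    = (m + 1) * total_displacement h T + n"
proof -
  let ?I = "\<lambda>p. between (links T) (h (the (item T p))) p"
  have "(\<Sum>a\<in>{1..m}. total_displacement (h(Suc n := a)) (insert_item Early m (Suc n) a T))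
    = (\<Sum>a\<in>{1..m}. total_displacement h T + (if a \<in> occ then 1 + card {p \<in> occ. a \<in> ?I p} else 0))"
    by (intro sum.cong refl)
      (simp add: total_displacement_insert_empty total_displacement_insert_Early)
  also have "\<dots> = m * total_displacement h T + (n + (\<Sum>a\<in>occ. card {p \<in> occ. a \<in> ?I p}))"
    unfolding sum.distrib[of "\<lambda>_. total_displacement h T"] sum_split_occupied
      sum.distrib[of "\<lambda>_. 1"]
    by (simp add: card_occupied)
  \<comment> \<open>Double counting: each item is counted once for every cell whose outgoing link
    lies on its search path, that is, as often as its displacement.\<close>
  also have "(\<Sum>a\<in>occ. card {p \<in> occ. a \<in> ?I p}) = (\<Sum>p\<in>occ. card {a \<in> occ. a \<in> ?I p})"
    by (intro sum_multicount_gen[symmetric] finite_occupied) auto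
  also have "\<dots> = total_displacement h T"
  proof -
    have "{a \<in> occ. a \<in> ?I p} = ?I p" if "p \<in> occ" for p
      using that reach_occupied by (auto simp: between_def)
    then show ?thesis by (simp add: total_displacement_def)
  qed
  also have "m * total_displacement h T + (n + total_displacement h T) = (m + 1) * total_displacement h T + n"
    by simp
  finally show ?thesis .
qed

end

end

section \<open>Tables built from a sequence of addresses\<close>

lemma build_table_cong:
  "(\<And>i. i \<in> {1..n} \<Longrightarrow> h i = h' i) \<Longrightarrow> build_table pol m h n = build_table pol m h' n"
  by (induction n) auto

text \<open>This allows the last address to vary over a fixed table of the first \<open>n\<close>
  items, as in the sums over \<open>a\<close>.\<close>

lemma build_table_insert:
  "build_table pol m (h(Suc n := a)) (Suc n) = insert_item pol m (Suc n) a (build_table pol m h n)"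
proof -
  have "build_table pol m (h(Suc n := a)) n = build_table pol m h n"
    by (rule build_table_cong) auto
  then show ?thesis by simp
qed

lemma coalesced_build_table:
  assumes "n \<le> m" "h ` {1..n} \<subseteq> {1..m}"
  shows "coalesced_table m n h (build_table pol m h n)"
  using assms
proof (induction n)
  case 0
  show ?case
    by unfold_locales (auto simp: occupied_def links_def acyclic_def single_valued_def)
next
  case (Suc n)
  then have "coalesced_table m n h (build_table pol m h n)" by force
  moreover have "n < m" "h (Suc n) \<in> {1..m}"
    using Suc.prems by (simp, simp only: image_subset_iff, simp)
  ultimately have "coalesced_table m (Suc n) (h(Suc n := h (Suc n)))
      (insert_item pol m (Suc n) (h (Suc n)) (build_table pol m h n))"
    by (rule coalesced_table.coalesced_table_insert_item)
  then show ?case by simp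
qed

lemma unsuccessful_eq_card_above:
  assumes "coalesced_table m n h (build_table pol m h n)"
  shows "unsuccessful pol m n h j = (if j \<in> occupied (build_table pol m h n)
    then card (coalesced_table.above (build_table pol m h n) j) else 0)"
proof -
  let ?T = "build_table pol m h n"
  interpret coalesced_table m n h ?T by fact
  show ?thesis
  proof (cases "j \<in> occ")
    case True
    have "{c. \<exists>k>0. follow ?T j k = Some c} = {c. (j, c) \<in> (links ?T)\<^sup>+}"
      by (auto simp: follow_eq_Some_iff trancl_power)
    \<comment> \<open>Acyclicity keeps \<open>j\<close> out of its own transitive closure, and the
      \<open>1 +\<close> in \<open>unsuccessful\<close> restores it.\<close>
    also have "\<dots> = above j - {j}"
      using acyclic_links by (auto simp: above_def rtrancl_eq_or_trancl acyclic_def)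
    finally have "1 + card {c. \<exists>k>0. follow ?T j k = Some c} = card (above j)"
      using finite_below_above[OF True] self_below_above(2)
      by (metis Suc_eq_plus1_left card_Suc_Diff1)
    then show ?thesis
      using True by (auto simp: unsuccessful_def Let_def occupied_def)
  next
    case False
    then show ?thesis by (auto simp: unsuccessful_def occupied_def Let_def)
  qed
qed

lemma sum_unsuccessful:
  assumes "n \<le> m" "h ` {1..n} \<subseteq> {1..m}"
  shows "(\<Sum>j\<in>{1..m}. unsuccessful pol m n h j) = reach_pairs (build_table pol m h n)"
proof -
  interpret coalesced_table m n h "build_table pol m h n"
    using assms by (rule coalesced_build_table)
  show ?thesis
    unfolding unsuccessful_eq_card_above[OF coalesced_table_axioms] sum_split_occupied
    by (simp add: sum_card_above)
qed

lemma sum_displacement: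
  assumes "n \<le> m" "h ` {1..n} \<subseteq> {1..m}"
  shows "(\<Sum>i\<in>{1..n}. displacement pol m n h i) = total_displacement h (build_table pol m h n)"
proof -
  let ?T = "build_table pol m h n"
  interpret coalesced_table m n h ?T
    using assms by (rule coalesced_build_table)
  have "bij_betw (\<lambda>p. the (item ?T p)) occ {1..n}"
    unfolding bij_betw_def
  proof
    show "inj_on (\<lambda>p. the (item ?T p)) occ"
    proof (rule inj_onI)
      fix p q assume "p \<in> occ" "q \<in> occ" "the (item ?T p) = the (item ?T q)"
      moreover from this have "item ?T p = item ?T q" by (auto simp: occupied_def)
      ultimately show "p = q" using inj_onD[OF inj_item] by blast
    qed
    show "(\<lambda>p. the (item ?T p)) ` occ = {1..n}"
      unfolding ran_item[symmetric] by (force simp: ran_def occupied_def)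
  qed
  then have "(\<Sum>i\<in>{1..n}. displacement pol m n h i) = (\<Sum>p\<in>occ. displacement pol m n h (the (item ?T p)))"
    by (rule sum.reindex_bij_betw[symmetric])
  also have "\<dots> = (\<Sum>p\<in>occ. card (between (links ?T) (h (the (item ?T p))) p))"
  proof (rule sum.cong[OF refl])
    fix p assume p: "p \<in> occ"
    then obtain i where i: "item ?T p = Some i" by (auto simp: occupied_def)
    then have the_i: "the (item ?T p) = i" by simp
    \<comment> \<open>An item occupies one cell only, so the existential quantifier in
      \<open>displacement\<close> reduces to \<open>c = p\<close>.\<close>
    have "item ?T c = Some i \<longleftrightarrow> c = p" for c
      using inj_onD[OF inj_item, of c p] p i by (auto simp: occupied_def)
    then show "displacement pol m n h (the (item ?T p))
        = card (between (links ?T) (h (the (item ?T p))) p)"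
      using Least_follow_eq_card_between[OF acyclic_links home_reaches_item[OF i]]
      unfolding the_i by (simp add: displacement_def)
  qed
  finally show ?thesis by (simp add: total_displacement_def)
qed

section \<open>Expectations over random hash addresses\<close>

lemma expectation_cong_pmf:
  fixes f g :: "'a \<Rightarrow> real"
  assumes "\<And>x. x \<in> set_pmf p \<Longrightarrow> f x = g x"
  shows "measure_pmf.expectation p f = measure_pmf.expectation p g"
  using assms by (intro integral_cong_AE) (auto simp: AE_measure_pmf_iff)

lemma expectation_pair_pmf:
  fixes f :: "'a \<times> 'b \<Rightarrow> real"
  assumes "finite (set_pmf p)" "finite (set_pmf q)"
  shows "measure_pmf.expectation (pair_pmf p q) f
    = measure_pmf.expectation p (\<lambda>x. measure_pmf.expectation q (\<lambda>y. f (x, y)))"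
proof -
  have "measure_pmf.expectation (pair_pmf p q) f
      = (\<Sum>z\<in>set_pmf p \<times> set_pmf q. f z * pmf (pair_pmf p q) z)"
    using assms by (intro integral_measure_pmf_real) auto
  also have "\<dots> = (\<Sum>x\<in>set_pmf p. \<Sum>y\<in>set_pmf q. f (x, y) * (pmf p x * pmf q y))"
    unfolding sum.cartesian_product by (intro sum.cong refl) (auto simp: pmf_pair)
  also have "\<dots> = (\<Sum>x\<in>set_pmf p. (\<Sum>y\<in>set_pmf q. f (x, y) * pmf q y) * pmf p x)"
    by (simp add: sum_distrib_left mult_ac)
  also have "\<dots> = measure_pmf.expectation p (\<lambda>x. \<Sum>y\<in>set_pmf q. f (x, y) * pmf q y)"
    using assms by (intro integral_measure_pmf_real[symmetric]) auto
  also have "(\<lambda>x. \<Sum>y\<in>set_pmf q. f (x, y) * pmf q y)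
      = (\<lambda>x. measure_pmf.expectation q (\<lambda>y. f (x, y)))"
    using assms by (intro ext integral_measure_pmf_real[symmetric]) auto
  finally show ?thesis .
qed

context
  fixes m :: nat
  assumes m_pos: "0 < m"
begin

lemma set_random_hashes: "set_pmf (random_hashes m n) = PiE_dflt {1..n} 0 (\<lambda>_. {1..m})"
  using m_pos by (simp add: random_hashes_def set_Pi_pmf o_def)

lemma finite_random_hashes: "finite (set_pmf (random_hashes m n))"
  unfolding set_random_hashes by (rule finite_PiE_dflt) auto

lemma random_hashes_range: "h \<in> set_pmf (random_hashes m n) \<Longrightarrow> h ` {1..n} \<subseteq> {1..m}"
  by (auto simp: set_random_hashes PiE_dflt_def)

text \<open>Conditioning on the first \<open>n\<close> addresses: the last one is uniform and
  independent of them.\<close>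

lemma expectation_random_hashes_Suc:
  fixes f :: "(nat \<Rightarrow> nat) \<Rightarrow> real"
  shows "measure_pmf.expectation (random_hashes m (Suc n)) f
    = measure_pmf.expectation (random_hashes m n) (\<lambda>h. (\<Sum>a\<in>{1..m}. f (h(Suc n := a))) / m)"
proof -
  have "random_hashes m (Suc n)
      = map_pmf (\<lambda>(a, h). h(Suc n := a)) (pair_pmf (pmf_of_set {1..m}) (random_hashes m n))"
  proof -
    have "{1..Suc n} = insert (Suc n) {1..n}" by auto
    then show ?thesis unfolding random_hashes_def by (simp only:) (rule Pi_pmf_insert, auto)
  qed
  \<comment> \<open>\<open>Pi_pmf_insert\<close> draws the new coordinate first; the swap makes the
    average over \<open>a\<close> the inner one.\<close>
  also have "\<dots> = map_pmf (\<lambda>(h, a). h(Suc n := a)) (pair_pmf (random_hashes m n) (pmf_of_set {1..m}))"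
    by (subst pair_commute_pmf) (simp add: pmf.map_comp o_def case_prod_unfold)
  finally show ?thesis
    using m_pos finite_random_hashes
    by (simp add: expectation_pair_pmf integral_pmf_of_set)
qed

section \<open>Recursions for the means\<close>

definition mean_reach_pairs :: "policy \<Rightarrow> nat \<Rightarrow> real" where
  "mean_reach_pairs pol n
    = measure_pmf.expectation (random_hashes m n) (\<lambda>h. reach_pairs (build_table pol m h n))"

definition mean_displacement :: "policy \<Rightarrow> nat \<Rightarrow> real" where
  "mean_displacement pol n
    = measure_pmf.expectation (random_hashes m n) (\<lambda>h. total_displacement h (build_table pol m h n))"

lemma random_hashes_0: "random_hashes m 0 = return_pmf (\<lambda>_. 0)"
  by (simp add: random_hashes_def)

lemma integrable_random_hashes:
  fixes f :: "(nat \<Rightarrow> nat) \<Rightarrow> real"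
  shows "integrable (measure_pmf (random_hashes m n)) f"
  by (rule integrable_measure_pmf_finite[OF finite_random_hashes])

lemma mean_reach_pairs_0: "mean_reach_pairs pol 0 = 0"
  by (simp add: mean_reach_pairs_def random_hashes_0 reach_pairs_def occupied_def)

lemma mean_displacement_0: "mean_displacement pol 0 = 0"
  by (simp add: mean_displacement_def random_hashes_0 total_displacement_def occupied_def)

lemma mean_reach_pairs_Suc:
  assumes "n < m"
  shows "mean_reach_pairs pol (Suc n) = (1 + 2 / m) * mean_reach_pairs pol n + (1 - n / m)"
proof -
  \<comment> \<open>The recursion holds for each fixed choice of the first \<open>n\<close>
    addresses. Membership in the support places them in \<open>{1..m}\<close>, as the invariant
    requires.\<close>
  have step: "(\<Sum>a\<in>{1..m}. real (reach_pairs (build_table pol m (h(Suc n := a)) (Suc n)))) / m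
      = (1 + 2 / m) * real (reach_pairs (build_table pol m h n)) + (1 - n / m)"
    if "h \<in> set_pmf (random_hashes m n)" for h
  proof -
    have "coalesced_table m n h (build_table pol m h n)"
      using assms random_hashes_range[OF that] by (intro coalesced_build_table) auto
    from coalesced_table.sum_reach_pairs[OF this assms, of pol]
    show ?thesis
      unfolding build_table_insert of_nat_sum[symmetric]
      using assms by (simp add: of_nat_diff field_simps)
  qed
  show ?thesis
    unfolding mean_reach_pairs_def expectation_random_hashes_Suc
    by (subst expectation_cong_pmf[OF step]) (simp_all add: integrable_random_hashes)
qed

lemma mean_displacement_Late_Suc:
  assumes "n < m"
  shows "mean_displacement Late (Suc n) = mean_displacement Late n + mean_reach_pairs Late n / m"
proof -
  have step: "(\<Sum>a\<in>{1..m}. real (total_displacement (h(Suc n := a)) (build_table Late m (h(Suc n := a)) (Suc n)))) / m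
      = real (total_displacement h (build_table Late m h n)) + real (reach_pairs (build_table Late m h n)) / m"
    if "h \<in> set_pmf (random_hashes m n)" for h
  proof -
    have "coalesced_table m n h (build_table Late m h n)"
      using assms random_hashes_range[OF that] by (intro coalesced_build_table) auto
    from coalesced_table.sum_total_displacement_Late[OF this assms]
    show ?thesis
      unfolding build_table_insert of_nat_sum[symmetric]
      using assms by (simp add: field_simps)
  qed
  show ?thesis
    unfolding mean_displacement_def mean_reach_pairs_def expectation_random_hashes_Suc
    by (subst expectation_cong_pmf[OF step]) (simp_all add: integrable_random_hashes)
qed

lemma mean_displacement_Early_Suc:
  assumes "n < m"
  shows "mean_displacement Early (Suc n) = (1 + 1 / m) * mean_displacement Early n + n / m"
proof -
  have step: "(\<Sum>a\<in>{1..m}. real (total_displacement (h(Suc n := a)) (build_table Early m (h(Suc n := a)) (Suc n)))) / m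
      = (1 + 1 / m) * real (total_displacement h (build_table Early m h n)) + n / m"
    if "h \<in> set_pmf (random_hashes m n)" for h
  proof -
    have "coalesced_table m n h (build_table Early m h n)"
      using assms random_hashes_range[OF that] by (intro coalesced_build_table) auto
    from coalesced_table.sum_total_displacement_Early[OF this assms]
    show ?thesis
      unfolding build_table_insert of_nat_sum[symmetric]
      using assms by (simp add: field_simps)
  qed
  show ?thesis
    unfolding mean_displacement_def expectation_random_hashes_Suc
    by (subst expectation_cong_pmf[OF step]) (simp_all add: integrable_random_hashes)
qed

section \<open>Closed forms of the means\<close>

lemma mean_reach_pairs_eq:
  "n \<le> m \<Longrightarrow> mean_reach_pairs pol n = m / 4 * ((1 + 2 / m) ^ n - 1) + n / 2"
proof (induction n)
  case (Suc n)
  \<comment> \<open>Here \<open>q\<close> stands for the power \<open>(1 + 2 / m) ^ n\<close>; for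
    arbitrary \<open>q\<close> the induction step is an identity of rational expressions.\<close>
  have "(1 + 2 / m) * (m / 4 * (q - 1) + n / 2) + (1 - n / m)
      = m / 4 * ((1 + 2 / m) * q - 1) + Suc n / 2" for q :: real
    using m_pos by (simp add: field_simps)
  with Suc show ?case by (simp add: mean_reach_pairs_Suc)
qed (simp add: mean_reach_pairs_0)

text \<open>The sum of \<open>mean_reach_pairs Late i / m\<close> over \<open>i < n\<close>: the
  powers form a geometric series, the constants add up to \<open>- n / 4\<close>, and the terms
  \<open>i / (2 * m)\<close> give the last fraction.\<close>

lemma mean_displacement_Late_eq:
  "n \<le> m \<Longrightarrow> mean_displacement Late n
    = m / 8 * ((1 + 2 / m) ^ n - 1) - n / 4 + n * (real n - 1) / (4 * m)"
proof (induction n)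
  case (Suc n)
  have "m / 8 * (q - 1) - n / 4 + n * (real n - 1) / (4 * m) + (m / 4 * (q - 1) + n / 2) / m
      = m / 8 * ((1 + 2 / m) * q - 1) - Suc n / 4 + Suc n * (real (Suc n) - 1) / (4 * m)" for q :: real
    using m_pos by (simp add: field_simps)
  with Suc show ?case by (simp add: mean_displacement_Late_Suc mean_reach_pairs_eq)
qed (simp add: mean_displacement_0)

lemma mean_displacement_Early_eq:
  "n \<le> m \<Longrightarrow> mean_displacement Early n = m * ((1 + 1 / m) ^ n - 1) - n"
proof (induction n)
  case (Suc n)
  have "(1 + 1 / m) * (m * (q - 1) - n) + n / m = m * ((1 + 1 / m) * q - 1) - Suc n" for q :: real
    using m_pos by (simp add: field_simps)
  with Suc show ?case by (simp add: mean_displacement_Early_Suc)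
qed (simp add: mean_displacement_0)

lemma expected_d_unsuccessful:
  assumes "n \<le> m"
  shows "expected (d_unsuccessful pol m n) = mean_reach_pairs pol n / m"
proof -
  have "expected (d_unsuccessful pol m n)
      = measure_pmf.expectation (random_hashes m n) (\<lambda>h. (\<Sum>j\<in>{1..m}. real (unsuccessful pol m n h j)) / m)"
    using m_pos finite_random_hashes
    by (simp add: expected_def d_unsuccessful_def case_prod_unfold expectation_pair_pmf integral_pmf_of_set)
  also have "\<dots> = measure_pmf.expectation (random_hashes m n) (\<lambda>h. real (reach_pairs (build_table pol m h n)) / m)"
    by (rule expectation_cong_pmf)
      (simp only: of_nat_sum[symmetric] sum_unsuccessful[OF assms random_hashes_range])
  finally show ?thesis by (simp add: mean_reach_pairs_def)
qed

lemma expected_d_item: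
  assumes "0 < n" "n \<le> m"
  shows "expected (d_item pol m n) = mean_displacement pol n / n"
proof -
  have "expected (d_item pol m n)
      = measure_pmf.expectation (random_hashes m n) (\<lambda>h. (\<Sum>i\<in>{1..n}. real (displacement pol m n h i)) / n)"
    using assms(1) finite_random_hashes
    by (simp add: expected_def d_item_def case_prod_unfold expectation_pair_pmf integral_pmf_of_set)
  also have "\<dots> = measure_pmf.expectation (random_hashes m n)
      (\<lambda>h. real (total_displacement h (build_table pol m h n)) / n)"
    by (rule expectation_cong_pmf)
      (simp only: of_nat_sum[symmetric] sum_displacement[OF assms(2) random_hashes_range])
  finally show ?thesis by (simp add: mean_displacement_def)
qed

end

section \<open>The limit laws\<close>

text \<open>The terms are nonnegative, so convergence of the series gives integrability; without it
  the expectation would default to \<open>0\<close>.\<close>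

lemma expected_eqI:
  assumes "(\<lambda>k. real k * pmf D k) sums s"
  shows "expected D = s"
proof -
  have int: "integrable (count_space UNIV) (\<lambda>k. pmf D k *\<^sub>R real k)"
    using assms by (auto simp: integrable_count_space_nat_iff sums_iff mult.commute abs_mult)
  have "expected D = integral\<^sup>L (count_space UNIV) (\<lambda>k. pmf D k *\<^sub>R real k)"
    unfolding expected_def measure_pmf_eq_density by (subst integral_density) auto
  also have "\<dots> = s"
    using integral_count_space_nat[OF int] assms by (simp add: sums_iff mult.commute)
  finally show ?thesis .
qed

text \<open>The counterpart of \<open>integral_geometric_sums\<close> for means instead of total
  masses. With \<open>q = 1 - exp (- t)\<close> the weighted series sums to
  \<open>1 / (1 - q)\<^sup>2 = exp (2 * t)\<close>. Its partial sums are nonnegative and bounded by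
  the limit, so dominated convergence exchanges sum and integral, and the antiderivative
  \<open>G\<close> evaluates the result.\<close>

lemma integral_geometric_deriv_sums:
  fixes g G :: "real \<Rightarrow> real"
  assumes \<alpha>: "0 \<le> \<alpha>" and g: "continuous_on {0..\<alpha>} g" "\<And>t. t \<in> {0..\<alpha>} \<Longrightarrow> 0 \<le> g t"
    and G: "\<And>t. t \<in> {0..\<alpha>} \<Longrightarrow> (G has_real_derivative g t * exp (2 * t)) (at t)"
  shows "(\<lambda>k. real (Suc k) * integral {0..\<alpha>} (\<lambda>t. g t * (1 - exp (- t)) ^ k)) sums (G \<alpha> - G 0)"
proof -
  define f where "f k t = g t * (real (Suc k) * (1 - exp (- t)) ^ k)" for k t
  have int: "f k integrable_on {0..\<alpha>}" for k
    unfolding f_def by (intro integrable_continuous_interval continuous_intros g)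
  have sums: "(\<lambda>k. f k t) sums (g t * exp (2 * t))" and nonneg: "0 \<le> f k t"
    if t: "t \<in> {0..\<alpha>}" for t k
  proof -
    have "(\<lambda>k. real (Suc k) * (1 - exp (- t)) ^ k) sums (1 / (1 - (1 - exp (- t)))\<^sup>2)"
      using t by (intro geometric_deriv_sums) auto
    moreover have "1 / (1 - (1 - exp (- t)))\<^sup>2 = exp (2 * t)"
      by (simp add: exp_minus power_inverse exp_double divide_inverse)
    ultimately show "(\<lambda>k. f k t) sums (g t * exp (2 * t))"
      unfolding f_def by (intro sums_mult) simp
    show "0 \<le> f k t"
      unfolding f_def using t g(2)[OF t] by simp
  qed
  have "(\<lambda>n. integral {0..\<alpha>} (\<lambda>t. \<Sum>k<n. f k t)) \<longlonglongrightarrow> integral {0..\<alpha>} (\<lambda>t. g t * exp (2 * t))"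
  proof (rule dominated_convergence)
    show "(\<lambda>t. \<Sum>k<n. f k t) integrable_on {0..\<alpha>}" for n
      by (intro integrable_sum int) auto
    show "(\<lambda>t. g t * exp (2 * t)) integrable_on {0..\<alpha>}"
      by (intro integrable_continuous_interval continuous_intros g)
  next
    fix n t assume t: "t \<in> {0..\<alpha>}"
    show "(\<lambda>n. \<Sum>k<n. f k t) \<longlonglongrightarrow> g t * exp (2 * t)"
      using sums[OF t] by (simp add: sums_def)
    have "(\<Sum>k<n. f k t) \<le> g t * exp (2 * t)"
      using sum_le_suminf[of "\<lambda>k. f k t" "{..<n}"] sums[OF t] nonneg[OF t] by (simp add: sums_iff)
    then show "norm (\<Sum>k<n. f k t) \<le> g t * exp (2 * t)"
      using sum_nonneg[of "{..<n}" "\<lambda>k. f k t"] nonneg[OF t] by simp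
  qed
  moreover have "((\<lambda>t. g t * exp (2 * t)) has_integral G \<alpha> - G 0) {0..\<alpha>}"
    using \<alpha> G by (intro fundamental_theorem_of_calculus)
      (auto simp: has_real_derivative_iff_has_vector_derivative[symmetric]
            intro: has_field_derivative_at_within)
  moreover have "integral {0..\<alpha>} (f k)
      = real (Suc k) * integral {0..\<alpha>} (\<lambda>t. g t * (1 - exp (- t)) ^ k)" for k
    unfolding f_def by (simp only: mult.left_commute[of "g _"] integral_mult_right)
  ultimately show ?thesis
    using int by (simp add: sums_def integral_sum integral_unique)
qed

text \<open>The term at \<open>k = 0\<close> vanishes, so the series may start at \<open>1\<close>,
  where the probabilities have their integral form.\<close>

lemma sums_real_mult_iff: "(\<lambda>k. real k * f k) sums s \<longleftrightarrow> (\<lambda>k. real (Suc k) * f (Suc k)) sums s"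
  using sums_Suc_iff[of "\<lambda>k. real k * f k" s] by simp

lemma expected_D_U:
  assumes "\<alpha> \<in> {0..1}"
  shows "expected (D_U \<alpha>) = 1 / 4 * (exp (2 * \<alpha>) - 1) + \<alpha> / 2"
proof -
  \<comment> \<open>Integration by parts of \<open>(1 - \<alpha> + t) * exp (2 * t)\<close>.\<close>
  define G where "G t = ((1 - \<alpha> + t) / 2 - 1 / 4) * exp (2 * t)" for t
  have "(\<lambda>k. real (Suc k) * integral {0..\<alpha>} (\<lambda>t. (1 - \<alpha> + t) * (1 - exp (- t)) ^ k))
      sums (G \<alpha> - G 0)"
    unfolding G_def by (rule integral_geometric_deriv_sums)
      (use assms in \<open>auto intro!: continuous_intros derivative_eq_intros simp: field_simps\<close>)
  then have "(\<lambda>k. real (Suc k) * pmf (D_U \<alpha>) (Suc k)) sums (G \<alpha> - G 0)"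
    by (simp add: pmf_D_U[OF assms] p_U_def)
  then have "expected (D_U \<alpha>) = G \<alpha> - G 0"
    by (intro expected_eqI) (simp only: sums_real_mult_iff)
  then show ?thesis by (simp add: G_def field_simps)
qed

text \<open>Keeping everything under one factor \<open>1 / \<alpha>\<close> makes the formula valid
  at \<alpha> = 0 too, where division by zero turns both sides into \<open>0\<close>.\<close>

lemma expected_D_L:
  assumes "\<alpha> \<in> {0..1}"
  shows "expected (D_L \<alpha>) = 1 / \<alpha> * ((exp (2 * \<alpha>) - 1) / 8 - \<alpha> / 4 + \<alpha>\<^sup>2 / 4)"
proof -
  define G where "G t = (1 / 8 + (\<alpha> - t) / 4 - (\<alpha> - t)\<^sup>2 / 4) * exp (2 * t)" for t
  have "(\<lambda>k. real (Suc k) * integral {0..\<alpha>} (\<lambda>t. (\<alpha> - t - (\<alpha> - t)\<^sup>2 / 2) * (1 - exp (- t)) ^ k))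
      sums (G \<alpha> - G 0)"
    unfolding G_def
  proof (rule integral_geometric_deriv_sums)
    show "0 \<le> \<alpha> - t - (\<alpha> - t)\<^sup>2 / 2" if "t \<in> {0..\<alpha>}" for t
      using that assms by (intro quadratic_nonneg) auto
  qed (use assms in \<open>auto intro!: continuous_intros derivative_eq_intros
         simp: field_simps power2_eq_square\<close>)
  then have "(\<lambda>k. 1 / \<alpha> * (real (Suc k)
      * integral {0..\<alpha>} (\<lambda>t. (\<alpha> - t - (\<alpha> - t)\<^sup>2 / 2) * (1 - exp (- t)) ^ k)))
      sums (1 / \<alpha> * (G \<alpha> - G 0))"
    by (rule sums_mult)
  then have "(\<lambda>k. real (Suc k) * pmf (D_L \<alpha>) (Suc k)) sums (1 / \<alpha> * (G \<alpha> - G 0))"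
    by (simp add: pmf_D_L[OF assms] p_L_def)
  then have "expected (D_L \<alpha>) = 1 / \<alpha> * (G \<alpha> - G 0)"
    by (intro expected_eqI) (simp only: sums_real_mult_iff)
  moreover have "G \<alpha> - G 0 = (exp (2 * \<alpha>) - 1) / 8 - \<alpha> / 4 + \<alpha>\<^sup>2 / 4"
    by (simp add: G_def field_simps)
  ultimately show ?thesis by simp
qed

lemma expected_D_E:
  assumes "\<alpha> \<in> {0..1}"
  shows "expected (D_E \<alpha>) = 1 / \<alpha> * (exp \<alpha> - 1 - \<alpha>)"
proof -
  \<comment> \<open>The factor \<open>exp (- t)\<close> of the density reduces
    \<open>exp (2 * t)\<close> to \<open>exp t\<close>, so \<open>G\<close> is an antiderivative of
    \<open>(\<alpha> - t) * exp t\<close>.\<close>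
  define G where "G t = (1 + \<alpha> - t) * exp t" for t
  have [simp]: "exp (- t) * exp (2 * t) = exp t" for t :: real
    by (simp add: mult_exp_exp)
  have "(\<lambda>k. real (Suc k) * integral {0..\<alpha>} (\<lambda>t. (\<alpha> - t) * exp (- t) * (1 - exp (- t)) ^ k))
      sums (G \<alpha> - G 0)"
  proof (rule integral_geometric_deriv_sums)
    have "(G has_real_derivative (\<alpha> - t) * exp t) (at t)" for t
      unfolding G_def by (auto intro!: derivative_eq_intros simp: algebra_simps)
    then show "(G has_real_derivative (\<alpha> - t) * exp (- t) * exp (2 * t)) (at t)" for t
      by (simp add: mult.assoc)
  qed (use assms in \<open>auto intro!: continuous_intros\<close>)
  then have "(\<lambda>k. 1 / \<alpha> * (real (Suc k)
      * integral {0..\<alpha>} (\<lambda>t. (\<alpha> - t) * exp (- t) * (1 - exp (- t)) ^ k)))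
      sums (1 / \<alpha> * (G \<alpha> - G 0))"
    by (rule sums_mult)
  then have "(\<lambda>k. real (Suc k) * pmf (D_E \<alpha>) (Suc k)) sums (1 / \<alpha> * (G \<alpha> - G 0))"
    by (simp add: pmf_D_E[OF assms] p_E_def)
  then have "expected (D_E \<alpha>) = 1 / \<alpha> * (G \<alpha> - G 0)"
    by (intro expected_eqI) (simp only: sums_real_mult_iff)
  then show ?thesis by (simp add: G_def algebra_simps)
qed

text \<open>The continuous extension of the difference quotient of \<open>exp (c * x)\<close> at
  zero; it absorbs the case \<alpha> = 0 both in the stated values and in the asymptotics.\<close>

definition exp_slope :: "real \<Rightarrow> real \<Rightarrow> real" where
  "exp_slope c x = (if x = 0 then c else (exp (c * x) - 1) / x)"

lemma exp_slope_limit: "(exp_slope c \<longlongrightarrow> c) (at 0)"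
proof -
  have "((\<lambda>x. exp (c * x)) has_real_derivative c) (at 0)"
    by (auto intro!: derivative_eq_intros)
  then have "((\<lambda>x. (exp (c * x) - 1) / x) \<longlongrightarrow> c) (at 0)"
    by (simp add: has_field_derivative_iff)
  then show ?thesis
    by (rule Lim_transform_eventually)
      (auto simp: exp_slope_def eventually_at intro!: exI[of _ 1])
qed

lemma isCont_exp_slope_1: "isCont (exp_slope 1) x"
proof (cases "x = 0")
  case True
  then show ?thesis
    using exp_slope_limit[of 1] by (simp add: isCont_def exp_slope_def)
next
  case False
  then have "isCont (\<lambda>x. (exp x - 1) / x) x"
    by (intro continuous_intros) auto
  moreover have "\<forall>\<^sub>F y in nhds x. exp_slope 1 y = (exp y - 1) / y"
    using t1_space_nhds[OF False] by eventually_elim (simp add: exp_slope_def)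
  ultimately show ?thesis by (simp add: isCont_cong)
qed

lemma limit_at_0_eqI:
  fixes x l :: real
  assumes "(f \<longlongrightarrow> l) (at_right 0)"
  shows "limit_at_0 f x = (if x = 0 then l else f x)"
  using tendsto_Lim[OF _ assms] by (simp add: limit_at_0_def)

lemma exp_slope_limit_right: "((\<lambda>x::real. (exp (c * x) - 1) / x) \<longlongrightarrow> c) (at_right 0)"
proof (rule Lim_transform_eventually)
  show "(exp_slope c \<longlongrightarrow> c) (at_right 0)"
    by (rule filterlim_mono[OF exp_slope_limit order_refl]) (simp add: at_within_le_at)
  show "\<forall>\<^sub>F x in at_right 0. exp_slope c x = (exp (c * x) - 1) / x"
    by (rule eventually_at_right_less[THEN eventually_mono]) (simp add: exp_slope_def)
qed

lemma limit_at_0_U: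
  "limit_at_0 (\<lambda>a. 1 / 4 * (exp (2 * a) - 1) + a / 2) x = 1 / 4 * (exp (2 * x) - 1) + x / 2"
proof -
  have "((\<lambda>a::real. 1 / 4 * (exp (2 * a) - 1) + a / 2) \<longlongrightarrow> 1 / 4 * (exp (2 * 0) - 1) + 0 / 2) (at_right 0)"
    by (intro tendsto_intros) simp_all
  from limit_at_0_eqI[OF this, of x] show ?thesis by simp
qed

lemma limit_at_0_L:
  "limit_at_0 (\<lambda>a. 1 / (8 * a) * (exp (2 * a) - 1) + a / 4 - 1 / 4) x = exp_slope 2 x / 8 + x / 4 - 1 / 4"
proof -
  have "((\<lambda>a::real. (exp (2 * a) - 1) / a / 8 + a / 4 - 1 / 4) \<longlongrightarrow> 2 / 8 + 0 / 4 - 1 / 4) (at_right 0)"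
    by (intro tendsto_intros exp_slope_limit_right) auto
  from limit_at_0_eqI[OF this, of x] show ?thesis
    by (simp add: exp_slope_def field_simps)
qed

lemma limit_at_0_E:
  "limit_at_0 (\<lambda>a. 1 / a * (exp a - 1 - a)) x = exp_slope 1 x - 1"
proof -
  have "((\<lambda>a::real. (exp a - 1) / a - 1) \<longlongrightarrow> 0) (at_right 0)"
    using tendsto_diff[OF exp_slope_limit_right[of 1] tendsto_const[of 1]] by simp
  then have "((\<lambda>a::real. 1 / a * (exp a - 1 - a)) \<longlongrightarrow> 0) (at_right 0)"
    by (rule Lim_transform_eventually)
      (rule eventually_at_right_less[THEN eventually_mono], simp add: field_simps)
  from limit_at_0_eqI[OF this, of x] show ?thesis
    by (simp add: exp_slope_def field_simps)
qed

section \<open>Asymptotics\<close>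

context
  fixes m n :: "nat \<Rightarrow> nat" and \<alpha> :: real
  assumes m_lim: "filterlim m at_top sequentially"
    and n_pos: "\<And>k. 0 < n k" and n_le_m: "\<And>k. n k \<le> m k"
    and ratio: "(\<lambda>k. real (n k) / real (m k)) \<longlonglongrightarrow> \<alpha>"
begin

lemma m_pos: "0 < m k"
  using n_pos n_le_m less_le_trans by blast

text \<open>The logarithm of the limit of \<open>(1 + c / m) powr m\<close>.\<close>

lemma mult_ln_limit:
  assumes "0 < c"
  shows "(\<lambda>k. m k * ln (1 + c / m k)) \<longlonglongrightarrow> c"
proof -
  have "(\<lambda>k. (1 + c / real (m k)) powr real (m k)) \<longlonglongrightarrow> exp c"
    by (intro filterlim_compose[OF tendsto_exp_limit_at_top]
        filterlim_compose[OF filterlim_real_sequentially m_lim])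
  then have "(\<lambda>k. ln ((1 + c / real (m k)) powr real (m k))) \<longlonglongrightarrow> ln (exp c)"
    by (rule tendsto_ln) simp
  moreover have "1 + c / real (m k) > 0" for k
    using assms by (simp add: add_pos_nonneg)
  ultimately show ?thesis by (simp add: ln_powr less_imp_neq)
qed

text \<open>With \<open>y = n * ln (1 + c / m)\<close> the power equals \<open>exp y\<close>, and
  the expression factors into \<open>exp_slope 1 y\<close> and \<open>m * ln (1 + c / m)\<close>.
  Since \<open>y\<close> tends to \<open>\<alpha> * c\<close>, continuity of
  \<open>exp_slope 1\<close> also handles \<alpha> = 0, without a case distinction.\<close>

lemma growth_limit:
  assumes "0 < c"
  shows "(\<lambda>k. real (m k) / n k * ((1 + c / m k) ^ n k - 1)) \<longlonglongrightarrow> exp_slope c \<alpha>"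
proof -
  define y where "y k = n k * ln (1 + c / m k)" for k
  have pos: "1 + c / real (m k) > 1" for k
    using assms m_pos by simp
  have "(\<lambda>k. real (n k) / m k * (m k * ln (1 + c / m k))) \<longlonglongrightarrow> \<alpha> * c"
    by (intro tendsto_mult ratio mult_ln_limit assms)
  then have "y \<longlonglongrightarrow> \<alpha> * c"
    unfolding y_def using m_pos by (simp add: field_simps)
  then have "(\<lambda>k. exp_slope 1 (y k) * (m k * ln (1 + c / m k))) \<longlonglongrightarrow> exp_slope 1 (\<alpha> * c) * c"
    by (intro tendsto_mult mult_ln_limit assms isCont_tendsto_compose[OF isCont_exp_slope_1])
  moreover have "exp_slope 1 (y k) * (m k * ln (1 + c / m k))
      = real (m k) / n k * ((1 + c / m k) ^ n k - 1)" for k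
  proof -
    have "exp (y k) = (1 + c / m k) ^ n k"
      using pos[of k] by (simp add: y_def exp_of_nat_mult)
    moreover have ln: "ln (1 + c / m k) \<noteq> 0" using ln_gt_zero[OF pos[of k]] by simp
    moreover have "y k \<noteq> 0" using ln n_pos[of k] by (simp add: y_def)
    ultimately show ?thesis
      using n_pos[of k] by (simp add: exp_slope_def) (simp add: y_def)
  qed
  moreover have "exp_slope 1 (\<alpha> * c) * c = exp_slope c \<alpha>"
    using assms by (auto simp: exp_slope_def mult.commute)
  ultimately show ?thesis by simp
qed

end

theorem corollary2p2:
  fixes m n :: "nat \<Rightarrow> nat" and \<alpha> :: real and pol :: policy
  assumes "filterlim m at_top sequentially" and "filterlim n at_top sequentially"
    and "\<And>k. 0 < n k" and "\<And>k. n k \<le> m k"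
    and "\<alpha> \<in> {0..1}" and "(\<lambda>k. real (n k) / real (m k)) \<longlonglongrightarrow> \<alpha>"
  shows "((\<lambda>k. expected (d_unsuccessful pol (m k) (n k))) \<longlonglongrightarrow> expected (D_U \<alpha>)) \<and>
     expected (D_U \<alpha>) = limit_at_0 (\<lambda>a. 1 / 4 * (exp (2 * a) - 1) + a / 2) \<alpha> \<and>
     ((\<lambda>k. expected (d_item Late (m k) (n k))) \<longlonglongrightarrow> expected (D_L \<alpha>)) \<and>
     expected (D_L \<alpha>) = limit_at_0 (\<lambda>a. 1 / (8 * a) * (exp (2 * a) - 1) + a / 4 - 1 / 4) \<alpha> \<and>
     ((\<lambda>k. expected (d_item Early (m k) (n k))) \<longlonglongrightarrow> expected (D_E \<alpha>)) \<and>
     expected (D_E \<alpha>) = limit_at_0 (\<lambda>a. 1 / a * (exp a - 1 - a)) \<alpha>"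
proof -
  have m_pos: "0 < m k" for k
    using assms(3,4)[of k] by linarith
  note growth = growth_limit[OF assms(1,3,4,6)]
  have U: "expected (D_U \<alpha>) = 1 / 4 * (exp (2 * \<alpha>) - 1) + \<alpha> / 2"
    using assms(5) by (rule expected_D_U)
  have L: "expected (D_L \<alpha>) = exp_slope 2 \<alpha> / 8 + \<alpha> / 4 - 1 / 4"
    using expected_D_L[OF assms(5)] by (simp add: exp_slope_def field_simps power2_eq_square)
  have E: "expected (D_E \<alpha>) = exp_slope 1 \<alpha> - 1"
    using expected_D_E[OF assms(5)] by (simp add: exp_slope_def field_simps)
  \<comment> \<open>The factors \<open>n / m\<close> and \<open>m / n\<close> cancel; they are
    inserted to apply \<open>growth_limit\<close>. In the limit,
    \<open>\<alpha> * exp_slope 2 \<alpha>\<close> is \<open>exp (2 * \<alpha>) - 1\<close>, even at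
    \<alpha> = 0.\<close>
  have "(\<lambda>k. 1 / 4 * (real (n k) / m k * (real (m k) / n k * ((1 + 2 / m k) ^ n k - 1)))
      + real (n k) / m k / 2) \<longlonglongrightarrow> 1 / 4 * (\<alpha> * exp_slope 2 \<alpha>) + \<alpha> / 2"
    by (intro tendsto_intros growth assms(6)) simp_all
  moreover have "expected (d_unsuccessful pol (m k) (n k))
      = 1 / 4 * (real (n k) / m k * (real (m k) / n k * ((1 + 2 / m k) ^ n k - 1)))
        + real (n k) / m k / 2" for k
    using assms(3)[of k] m_pos[of k]
    by (simp add: expected_d_unsuccessful[OF m_pos assms(4)] mean_reach_pairs_eq[OF m_pos assms(4)]
        add_divide_distrib)
  moreover have "1 / 4 * (\<alpha> * exp_slope 2 \<alpha>) + \<alpha> / 2 = expected (D_U \<alpha>)"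
    by (simp add: U exp_slope_def)
  ultimately have U_lim: "(\<lambda>k. expected (d_unsuccessful pol (m k) (n k))) \<longlonglongrightarrow> expected (D_U \<alpha>)"
    by simp
  \<comment> \<open>Dividing \<open>n * (n - 1) / (4 * m)\<close> by \<open>n\<close> leaves
    \<open>(n / m - 1 / m) / 4\<close>, whose correction \<open>1 / m\<close> tends to zero.\<close>
  have "(\<lambda>k. real (m k) / n k * ((1 + 2 / m k) ^ n k - 1) / 8 - 1 / 4
      + (real (n k) / m k - 1 / m k) / 4) \<longlonglongrightarrow> exp_slope 2 \<alpha> / 8 - 1 / 4 + (\<alpha> - 0) / 4"
    by (intro tendsto_intros growth assms(6) filterlim_compose[OF lim_1_over_n assms(1)]) simp_all
  moreover have "expected (d_item Late (m k) (n k))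
      = real (m k) / n k * ((1 + 2 / m k) ^ n k - 1) / 8 - 1 / 4
        + (real (n k) / m k - 1 / m k) / 4" for k
  proof -
    have "(real (m k) / 8 * (q - 1) - n k / 4 + n k * (real (n k) - 1) / (4 * m k)) / n k
        = real (m k) / n k * (q - 1) / 8 - 1 / 4 + (real (n k) / m k - 1 / m k) / 4" for q :: real
      using assms(3)[of k] m_pos[of k] by (simp add: field_simps)
    then show ?thesis
      by (simp add: expected_d_item[OF m_pos assms(3,4)] mean_displacement_Late_eq[OF m_pos assms(4)])
  qed
  moreover have "exp_slope 2 \<alpha> / 8 - 1 / 4 + (\<alpha> - 0) / 4 = expected (D_L \<alpha>)"
    by (simp add: L)
  ultimately have L_lim: "(\<lambda>k. expected (d_item Late (m k) (n k))) \<longlonglongrightarrow> expected (D_L \<alpha>)"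
    by (simp only:)
  have "(\<lambda>k. real (m k) / n k * ((1 + 1 / m k) ^ n k - 1) - 1) \<longlonglongrightarrow> exp_slope 1 \<alpha> - 1"
    by (intro tendsto_intros growth) simp
  moreover have "expected (d_item Early (m k) (n k))
      = real (m k) / n k * ((1 + 1 / m k) ^ n k - 1) - 1" for k
    using assms(3)[of k]
    by (simp add: expected_d_item[OF m_pos assms(3,4)] mean_displacement_Early_eq[OF m_pos assms(4)]
        diff_divide_distrib)
  ultimately have E_lim: "(\<lambda>k. expected (d_item Early (m k) (n k))) \<longlonglongrightarrow> expected (D_E \<alpha>)"
    by (simp add: E)
  show ?thesis
    using U_lim L_lim E_lim U L E by (simp only: limit_at_0_U limit_at_0_L limit_at_0_E simp_thms)
qed

end
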